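(* Fix $\theta\in(1/2,7/8]$, $[\underline h,\bar h]\subset(0,1)$, $[\underline\alpha,\bar\alpha]\subset(0,1)$, $h_1\in(0,1]$, and integers $k\ge1$, $p\ge2$. Assume all $J_X\ge0$ (so both GKS inequalities hold), that the $J_X$ are independent with finite second moments and $\sum_X\mathrm{Var}(J_X)\le Cn$ for a constant $C$ independent of $n$, and let $C_P>0$ be a constant independent of $n,h_0,h_1,\alpha$ with $\mathbb E[(P_n-p_n)^2]\le C_P/n$ for all parameters. Then for all sufficiently large $n$, $$\int_{\underline h}^{\bar h}dh_0\int_{\underline\alpha}^{\bar\alpha}d\alpha\,\mathbb E\big\langle\big|Q_k^p-(\mathbb E\langle Q_k\rangle)^p\big|\big\rangle\le\frac{2pk}{(\tanh h_1)^{k/2}}\frac{(5C_P+40)^{1/4}}{n^{(\theta-1/2)/6}}.$$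
   Context: Spins $\boldsymbol\sigma\in\{-1,1\}^n$, $\sigma_X=\prod_{i\in X}\sigma_i$. Couplings $J_X$, $X\subset\{1,\dots,n\}$, independent; $\tau_1,\dots,\tau_n$ i.i.d. Poisson with mean $\alpha n^{\theta-1}$, independent of the couplings. Hamiltonian $\mathcal H(\boldsymbol\sigma)=-\sum_XJ_X\sigma_X-h_0\sum_i\sigma_i-h_1\sum_i\tau_i\sigma_i$, partition function $\mathcal Z$, Gibbs expectation $\langle\cdot\rangle$ depending on $h_0,h_1,\alpha$; for functions of $k$ replicas, $\langle\cdot\rangle$ is the expectation under the product of $k$ independent copies of the Gibbs measure. $Q_k=\frac1n\sum_i\sigma_i^{(1)}\cdots\sigma_i^{(k)}$. Pressure $P_n=\frac1n\ln\mathcal Z$, $p_n=\mathbb EP_n$, $\mathbb E$ over all $J_X$ and $\boldsymbol\tau$. GKS inequalities: $\langle\sigma_T\rangle\ge0$ and $\langle\sigma_T\sigma_S\rangle-\langle\sigma_T\rangle\langle\sigma_S\rangle\ge0$ for all $T,S$. *)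

theory Defs
  imports "HOL-Probability.Probability"
begin

text \<open>Sites are 0,...,n-1. A spin configuration is a function nat => real taking values
  +1/-1 on sites below n and fixed to 1 elsewhere (so the set is finite).\<close>
definition spin_configs :: "nat \<Rightarrow> (nat \<Rightarrow> real) set" where
  "spin_configs n = {\<sigma>. (\<forall>i<n. \<sigma> i = 1 \<or> \<sigma> i = -1) \<and> (\<forall>i. n \<le> i \<longrightarrow> \<sigma> i = 1)}"

definition replica_configs :: "nat \<Rightarrow> nat \<Rightarrow> (nat \<Rightarrow> nat \<Rightarrow> real) set" where
  "replica_configs n k = PiE {..<k} (\<lambda>_. spin_configs n)"

definition hamiltonian ::
  "nat \<Rightarrow> (nat set \<Rightarrow> real) \<Rightarrow> (nat \<Rightarrow> nat) \<Rightarrow> real \<Rightarrow> real \<Rightarrow> (nat \<Rightarrow> real) \<Rightarrow> real" where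
  "hamiltonian n J \<tau> h0 h1 \<sigma> =
     - (\<Sum>X\<in>Pow {..<n}. J X * (\<Prod>i\<in>X. \<sigma> i))
     - h0 * (\<Sum>i<n. \<sigma> i) - h1 * (\<Sum>i<n. real (\<tau> i) * \<sigma> i)"

definition partition_fun ::
  "nat \<Rightarrow> (nat set \<Rightarrow> real) \<Rightarrow> (nat \<Rightarrow> nat) \<Rightarrow> real \<Rightarrow> real \<Rightarrow> real" where
  "partition_fun n J \<tau> h0 h1 = (\<Sum>\<sigma>\<in>spin_configs n. exp (- hamiltonian n J \<tau> h0 h1 \<sigma>))"

definition gibbs ::
  "nat \<Rightarrow> (nat set \<Rightarrow> real) \<Rightarrow> (nat \<Rightarrow> nat) \<Rightarrow> real \<Rightarrow> real \<Rightarrow> nat \<Rightarrow>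
   ((nat \<Rightarrow> nat \<Rightarrow> real) \<Rightarrow> real) \<Rightarrow> real" where
  "gibbs n J \<tau> h0 h1 k f =
     (\<Sum>s\<in>replica_configs n k. f s * (\<Prod>r<k. exp (- hamiltonian n J \<tau> h0 h1 (s r))))
     / partition_fun n J \<tau> h0 h1 ^ k"

definition overlap :: "nat \<Rightarrow> nat \<Rightarrow> (nat \<Rightarrow> nat \<Rightarrow> real) \<Rightarrow> real" where
  "overlap n k s = (1 / real n) * (\<Sum>i<n. \<Prod>r<k. s r i)"

definition pressure ::
  "nat \<Rightarrow> (nat set \<Rightarrow> real) \<Rightarrow> (nat \<Rightarrow> nat) \<Rightarrow> real \<Rightarrow> real \<Rightarrow> real" where
  "pressure n J \<tau> h0 h1 = ln (partition_fun n J \<tau> h0 h1) / real n"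

definition disorder ::
  "(nat \<Rightarrow> nat set \<Rightarrow> real measure) \<Rightarrow> real \<Rightarrow> nat \<Rightarrow> real \<Rightarrow> ((nat set \<Rightarrow> real) \<times> (nat \<Rightarrow> nat)) measure" where
  "disorder D \<theta> n \<alpha> =
     (PiM (Pow {..<n}) (D n)) \<Otimes>\<^sub>M
     (PiM {..<n} (\<lambda>_. measure_pmf (poisson_pmf (\<alpha> * real n powr (\<theta> - 1)))))"

definition Edis ::
  "(nat \<Rightarrow> nat set \<Rightarrow> real measure) \<Rightarrow> real \<Rightarrow> nat \<Rightarrow> real \<Rightarrow>
   ((nat set \<Rightarrow> real) \<Rightarrow> (nat \<Rightarrow> nat) \<Rightarrow> real) \<Rightarrow> real" where
  "Edis D \<theta> n \<alpha> F = (\<integral>\<omega>. F (fst \<omega>) (snd \<omega>) \<partial>disorder D \<theta> n \<alpha>)"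

end

theory Submission
  imports Defs "HOL-Real_Asymp.Real_Asymp"
begin

text \<open>
  Since \<open>\<bar>q\<^sup>p - c\<^sup>p\<bar> \<le> p \<bar>q - c\<bar>\<close> on \<open>[-1, 1]\<close>, it suffices to bound the variance of the multi-overlap \<open>Q\<^sub>k\<close>
  under \<open>E\<langle>\<cdot>\<rangle>\<close>, which is the sum of a thermal part \<open>E(\<langle>Q\<^sub>k\<^sup>2\<rangle> - \<langle>Q\<^sub>k\<rangle>\<^sup>2)\<close> and a disorder part \<open>Var \<langle>Q\<^sub>k\<rangle>\<close>.
  Both reduce to \<open>k = 1\<close>. By the second GKS inequality the thermal part is at most \<open>k\<close> times that of
  the magnetization \<open>Q\<^sub>1\<close>, and this is \<open>1/n\<close> times the derivative of \<open>E\<langle>Q\<^sub>1\<rangle>\<close> in \<open>h\<^sub>0\<close>, so it integrates to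
  \<open>O(1/n)\<close>. The local magnetizations are nondecreasing functions of the independent variables
  \<open>J\<^sub>X\<close> and \<open>\<tau>\<^sub>i\<close>, hence by Harris' inequality \<open>\<langle>Q\<^sub>k\<rangle>\<close> and \<open>k \<langle>Q\<^sub>1\<rangle> - \<langle>Q\<^sub>k\<rangle>\<close> are positively
  correlated and \<open>Var \<langle>Q\<^sub>k\<rangle> \<le> k\<^sup>2 Var \<langle>Q\<^sub>1\<rangle>\<close>. Finally \<open>\<langle>Q\<^sub>1\<rangle>\<close> is the derivative in \<open>h\<^sub>0\<close> of the convex
  function \<open>P\<^sub>n\<close>, whose variance is at most \<open>C\<^sub>P/n\<close>; comparing it with difference quotients of
  step \<open>n\<close> to the power \<open>-1/4\<close> gives a deviation of order \<open>n\<close> to the power \<open>-1/8\<close>, which beats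
  \<open>(\<theta> - 1/2)/6 \<le> 1/16\<close>.
\<close>

section \<open>The Griffiths-Kelly-Sherman inequalities\<close>

lemma finite_spin_configs [simp]: "finite (spin_configs n)"
proof -
  have "inj_on (\<lambda>\<sigma>. restrict \<sigma> {..<n}) (spin_configs n)"
  proof (rule inj_onI)
    fix \<sigma> \<sigma>' assume a: "\<sigma> \<in> spin_configs n" "\<sigma>' \<in> spin_configs n"
      and e: "restrict \<sigma> {..<n} = restrict \<sigma>' {..<n}"
    show "\<sigma> = \<sigma>'"
    proof
      fix i show "\<sigma> i = \<sigma>' i"
        using a fun_cong[OF e, of i] by (cases "i < n") (auto simp: spin_configs_def)
    qed
  qed
  moreover have "(\<lambda>\<sigma>. restrict \<sigma> {..<n}) ` spin_configs n \<subseteq> PiE {..<n} (\<lambda>_. {1, -1})"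
    by (auto simp: spin_configs_def PiE_iff extensional_def split: if_splits)
  ultimately show ?thesis
    by (meson finite_PiE finite_lessThan finite.intros inj_on_finite)
qed

lemma one_in_spin_configs [simp]: "(\<lambda>_. 1) \<in> spin_configs n"
  by (simp add: spin_configs_def)

lemma abs_spin: "\<sigma> \<in> spin_configs n \<Longrightarrow> \<bar>\<sigma> i\<bar> = 1"
  by (cases "i < n") (auto simp: spin_configs_def)

lemma spin_mult_self: "\<sigma> \<in> spin_configs n \<Longrightarrow> \<sigma> i * \<sigma> i = 1"
  by (cases "i < n") (auto simp: spin_configs_def)

lemma mult_spin_configs:
  "\<sigma> \<in> spin_configs n \<Longrightarrow> \<tau> \<in> spin_configs n \<Longrightarrow> (\<lambda>i. \<sigma> i * \<tau> i) \<in> spin_configs n"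
  by (fastforce simp: spin_configs_def)

text \<open>Natural exponents stand in for subsets of sites, so that a product of monomials is a
  monomial with added exponents and no symmetric differences arise.\<close>

definition monomial :: "nat \<Rightarrow> (nat \<Rightarrow> nat) \<Rightarrow> (nat \<Rightarrow> real) \<Rightarrow> real" where
  "monomial n a \<sigma> = (\<Prod>i<n. \<sigma> i ^ a i)"

lemma monomial_add: "monomial n (\<lambda>i. a i + b i) \<sigma> = monomial n a \<sigma> * monomial n b \<sigma>"
  by (simp add: monomial_def power_add prod.distrib)

lemma monomial_indicator:
  assumes "X \<subseteq> {..<n}"
  shows "monomial n (\<lambda>i. if i \<in> X then 1 else 0) \<sigma> = (\<Prod>i\<in>X. \<sigma> i)"
proof -
  have "monomial n (\<lambda>i. if i \<in> X then 1 else 0) \<sigma> = (\<Prod>i<n. if i \<in> X then \<sigma> i else 1)"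
    unfolding monomial_def by (intro prod.cong) auto
  also have "\<dots> = (\<Prod>i\<in>X. \<sigma> i)"
    using assms by (simp add: prod.If_cases Int_absorb1)
  finally show ?thesis .
qed

lemma monomial_single: "j < n \<Longrightarrow> monomial n (\<lambda>i. if i = j then 1 else 0) \<sigma> = \<sigma> j"
  using monomial_indicator[of "{j}" n \<sigma>] by simp

lemma abs_monomial: "\<sigma> \<in> spin_configs n \<Longrightarrow> \<bar>monomial n a \<sigma>\<bar> = 1"
  by (simp add: monomial_def abs_prod power_abs abs_spin)

lemma monomial_mult: "monomial n a (\<lambda>i. \<sigma> i * \<tau> i) = monomial n a \<sigma> * monomial n a \<tau>"
  by (simp add: monomial_def power_mult_distrib prod.distrib)

lemma abs_prod_spin: "\<sigma> \<in> spin_configs n \<Longrightarrow> \<bar>\<Prod>i\<in>X. \<sigma> i\<bar> = 1"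
  by (simp add: abs_prod abs_spin)

text \<open>If some exponent is odd, flipping that spin permutes the configurations and reverses the
  sign, so the sum vanishes. Otherwise every term is nonnegative.\<close>

lemma sum_monomial_nonneg: "(\<Sum>\<sigma>\<in>spin_configs n. monomial n a \<sigma>) \<ge> 0"
proof (cases "\<exists>j<n. odd (a j)")
  case True
  then obtain j where j: "j < n" "odd (a j)" by blast
  let ?flip = "\<lambda>\<sigma>::nat \<Rightarrow> real. \<sigma>(j := - \<sigma> j)"
  have m: "monomial n a (?flip \<sigma>) = - monomial n a \<sigma>" for \<sigma>
  proof -
    have jn: "j \<in> {..<n}" using j by simp
    have "monomial n a (?flip \<sigma>) = (- \<sigma> j) ^ a j * (\<Prod>i\<in>{..<n}-{j}. \<sigma> i ^ a i)"
      unfolding monomial_def by (subst prod.remove[OF _ jn]) (auto intro!: prod.cong)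
    also have "\<dots> = - monomial n a \<sigma>"
      unfolding monomial_def by (subst prod.remove[OF _ jn]) (use j in auto)
    finally show ?thesis .
  qed
  have "(\<Sum>\<sigma>\<in>spin_configs n. monomial n a \<sigma>) = (\<Sum>\<sigma>\<in>spin_configs n. monomial n a (?flip \<sigma>))"
    by (rule sum.reindex_bij_witness[of _ ?flip ?flip])
       (use j in \<open>auto simp: spin_configs_def\<close>)
  also have "\<dots> = - (\<Sum>\<sigma>\<in>spin_configs n. monomial n a \<sigma>)"
    by (simp add: m sum_negf)
  finally show ?thesis by simp
next
  case False
  then show ?thesis
    by (intro sum_nonneg) (auto simp: monomial_def intro!: prod_nonneg zero_le_even_power)
qed

text \<open>Expanding the product gives sums of monomials, all nonnegative, so the coefficients can
  be replaced by dominating ones. The induction peels off one factor and absorbs its spin product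
  into the exponents, which is why \<open>a\<close> is arbitrary.\<close>

lemma abs_sum_monomial_prod_le:
  assumes "finite F" "\<And>X. X \<in> F \<Longrightarrow> X \<subseteq> {..<n}"
    and "\<And>X. X \<in> F \<Longrightarrow> \<bar>c X\<bar> \<le> c' X" "\<And>X. X \<in> F \<Longrightarrow> \<bar>s X\<bar> \<le> s' X"
  shows "\<bar>\<Sum>\<sigma>\<in>spin_configs n. monomial n a \<sigma> * (\<Prod>X\<in>F. c X + s X * (\<Prod>i\<in>X. \<sigma> i))\<bar>
    \<le> (\<Sum>\<sigma>\<in>spin_configs n. monomial n a \<sigma> * (\<Prod>X\<in>F. c' X + s' X * (\<Prod>i\<in>X. \<sigma> i)))"
  using assms
proof (induction F arbitrary: a rule: finite_induct)
  case empty
  then show ?case using sum_monomial_nonneg by simp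
next
  case (insert X F)
  define b where "b = (\<lambda>i. a i + (if i \<in> X then 1 else 0))"
  have b: "monomial n b \<sigma> = monomial n a \<sigma> * (\<Prod>i\<in>X. \<sigma> i)" for \<sigma>
    unfolding b_def monomial_add using insert.prems(1)[of X] by (simp add: monomial_indicator)
  define S where "S = (\<lambda>a c s. \<Sum>\<sigma>\<in>spin_configs n. monomial n a \<sigma> * (\<Prod>X\<in>F. c X + s X * (\<Prod>i\<in>X. \<sigma> i)))"
  have split: "(\<Sum>\<sigma>\<in>spin_configs n. monomial n a \<sigma> * (\<Prod>X\<in>insert X F. c X + s X * (\<Prod>i\<in>X. \<sigma> i)))
      = c X * S a c s + s X * S b c s" for c s
    using insert.hyps
    by (simp add: S_def b sum_distrib_left sum.distrib[symmetric] algebra_simps)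
  have IH: "\<bar>S a c s\<bar> \<le> S a c' s'" for a
    unfolding S_def by (intro insert.IH) (use insert.prems in auto)
  have "\<bar>c X * S a c s + s X * S b c s\<bar> \<le> \<bar>c X\<bar> * \<bar>S a c s\<bar> + \<bar>s X\<bar> * \<bar>S b c s\<bar>"
    by (metis abs_mult abs_triangle_ineq)
  also have "\<dots> \<le> c' X * S a c' s' + s' X * S b c' s'"
    using insert.prems(2,3)[of X] by (intro add_mono mult_mono IH) auto
  finally show ?case unfolding split .
qed

text \<open>High-temperature expansion: a Boltzmann factor becomes affine in the spin
  product.\<close>

lemma exp_mult_sign: "\<bar>x\<bar> = 1 \<Longrightarrow> exp (A * x) = cosh A + sinh A * (x::real)"
  by (cases "x = 1") (auto simp: cosh_def sinh_def field_simps abs_if split: if_splits)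

section \<open>Unnormalized correlations and their inequalities\<close>

definition ising_sum :: "nat \<Rightarrow> (nat set \<Rightarrow> real) \<Rightarrow> (nat \<Rightarrow> nat) \<Rightarrow> real" where
  "ising_sum n A a =
    (\<Sum>\<sigma>\<in>spin_configs n. monomial n a \<sigma> * exp (\<Sum>X\<in>Pow {..<n}. A X * (\<Prod>i\<in>X. \<sigma> i)))"

text \<open>The high-temperature coefficients \<open>cosh\<close> and \<open>sinh\<close> of
  \<open>B\<close> are dominated by those of \<open>A\<close>. \<open>B\<close> may have either
  sign, as happens after Ginibre's change of variables.\<close>

lemma abs_ising_sum_le:
  assumes "\<And>X. X \<subseteq> {..<n} \<Longrightarrow> \<bar>B X\<bar> \<le> A X"
  shows "\<bar>ising_sum n B a\<bar> \<le> ising_sum n A a"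
proof -
  have eq: "ising_sum n A a = (\<Sum>\<sigma>\<in>spin_configs n.
      monomial n a \<sigma> * (\<Prod>X\<in>Pow {..<n}. cosh (A X) + sinh (A X) * (\<Prod>i\<in>X. \<sigma> i)))" for A
    unfolding ising_sum_def
    by (intro sum.cong refl) (simp add: exp_sum exp_mult_sign abs_prod_spin)
  have "cosh (B X) \<le> cosh (A X)" "\<bar>sinh (B X)\<bar> \<le> sinh (A X)" if "X \<subseteq> {..<n}" for X
  proof -
    have "\<bar>B X\<bar> \<le> A X" using assms that by simp
    then show "cosh (B X) \<le> cosh (A X)"
      by (metis abs_ge_zero cosh_real_abs cosh_real_nonneg_le_iff order_trans)
    show "\<bar>sinh (B X)\<bar> \<le> sinh (A X)"
      using \<open>\<bar>B X\<bar> \<le> A X\<close> by (metis sinh_real_abs sinh_real_le_iff)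
  qed
  then show ?thesis
    unfolding eq by (intro abs_sum_monomial_prod_le) auto
qed

text \<open>Domination of the couplings by themselves bounds an absolute value by the sum itself.
  This is the first GKS inequality before normalization.\<close>

lemma ising_sum_nonneg:
  assumes "\<And>X. X \<subseteq> {..<n} \<Longrightarrow> 0 \<le> A X"
  shows "0 \<le> ising_sum n A a"
  using abs_ising_sum_le[of n A A a] assms by force

text \<open>Ginibre's change of variables: the second replica is replaced by its product \<open>\<tau>\<close> with the first.\<close>
lemma ising_sum_mult:
  "ising_sum n A a * ising_sum n B b =
    (\<Sum>\<tau>\<in>spin_configs n. monomial n b \<tau> *
      ising_sum n (\<lambda>X. A X + B X * (\<Prod>i\<in>X. \<tau> i)) (\<lambda>i. a i + b i))"
proof -
  let ?w = "\<lambda>A \<sigma>. exp (\<Sum>X\<in>Pow {..<n}. A X * (\<Prod>i\<in>X. \<sigma> i))"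
  have "ising_sum n A a * ising_sum n B b = (\<Sum>\<sigma>\<in>spin_configs n. \<Sum>\<tau>\<in>spin_configs n.
      monomial n a \<sigma> * ?w A \<sigma> * (monomial n b \<tau> * ?w B \<tau>))"
    by (simp add: ising_sum_def sum_product)
  also have "\<dots> = (\<Sum>\<sigma>\<in>spin_configs n. \<Sum>\<tau>\<in>spin_configs n.
      monomial n a \<sigma> * ?w A \<sigma> * (monomial n b (\<lambda>i. \<sigma> i * \<tau> i) * ?w B (\<lambda>i. \<sigma> i * \<tau> i)))"
  proof (rule sum.cong[OF refl])
    fix \<sigma> assume \<sigma>: "\<sigma> \<in> spin_configs n"
    show "(\<Sum>\<tau>\<in>spin_configs n. monomial n a \<sigma> * ?w A \<sigma> * (monomial n b \<tau> * ?w B \<tau>)) =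
      (\<Sum>\<tau>\<in>spin_configs n.
        monomial n a \<sigma> * ?w A \<sigma> * (monomial n b (\<lambda>i. \<sigma> i * \<tau> i) * ?w B (\<lambda>i. \<sigma> i * \<tau> i)))"
      by (rule sum.reindex_bij_witness[of _ "\<lambda>\<tau> i. \<sigma> i * \<tau> i" "\<lambda>\<tau> i. \<sigma> i * \<tau> i"])
         (use \<sigma> in \<open>auto simp: mult_spin_configs spin_mult_self mult.assoc[symmetric]\<close>)
  qed
  also have "\<dots> = (\<Sum>\<sigma>\<in>spin_configs n. \<Sum>\<tau>\<in>spin_configs n. monomial n b \<tau> *
      (monomial n (\<lambda>i. a i + b i) \<sigma> * ?w (\<lambda>X. A X + B X * (\<Prod>i\<in>X. \<tau> i)) \<sigma>))"
    by (intro sum.cong refl)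
       (simp add: monomial_add monomial_mult exp_add[symmetric] prod.distrib sum.distrib algebra_simps)
  also have "\<dots> = (\<Sum>\<tau>\<in>spin_configs n. monomial n b \<tau> *
      ising_sum n (\<lambda>X. A X + B X * (\<Prod>i\<in>X. \<tau> i)) (\<lambda>i. a i + b i))"
    by (subst sum.swap) (simp add: ising_sum_def sum_distrib_left)
  finally show ?thesis .
qed

text \<open>After the change of variables both sides are sums over \<tau> of the same Ising sum,
  with weight \<open>monomial n b \<tau>\<close> on the left and 1 on the right. Its couplings carry
  the factor \<open>1 + (\<Prod>i\<in>X. \<tau> i)\<close>, which is nonnegative, so the first
  inequality applies.\<close>

lemma ising_gks2:
  assumes "\<And>X. X \<subseteq> {..<n} \<Longrightarrow> 0 \<le> A X"
  shows "ising_sum n A a * ising_sum n A b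
    \<le> ising_sum n A (\<lambda>i. a i + b i) * ising_sum n A (\<lambda>_. 0)"
proof -
  let ?A = "\<lambda>\<tau> X. A X + A X * (\<Prod>i\<in>X. \<tau> i)"
  have "ising_sum n A a * ising_sum n A b = (\<Sum>\<tau>\<in>spin_configs n. monomial n b \<tau> *
      ising_sum n (?A \<tau>) (\<lambda>i. a i + b i))"
    by (rule ising_sum_mult)
  also have "\<dots> \<le> (\<Sum>\<tau>\<in>spin_configs n. monomial n (\<lambda>_. 0) \<tau> *
      ising_sum n (?A \<tau>) (\<lambda>i. a i + b i + 0))"
  proof (rule sum_mono)
    fix \<tau> assume \<tau>: "\<tau> \<in> spin_configs n"
    have "0 \<le> ?A \<tau> X" if "X \<subseteq> {..<n}" for X
    proof -
      have "\<bar>\<Prod>i\<in>X. \<tau> i\<bar> = 1" using abs_prod_spin[OF \<tau>] .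
      then have "0 \<le> 1 + (\<Prod>i\<in>X. \<tau> i)" by linarith
      then have "0 \<le> A X * (1 + (\<Prod>i\<in>X. \<tau> i))" using assms that by simp
      then show ?thesis by (simp add: algebra_simps)
    qed
    then have "0 \<le> ising_sum n (?A \<tau>) (\<lambda>i. a i + b i)" by (rule ising_sum_nonneg)
    then show "monomial n b \<tau> * ising_sum n (?A \<tau>) (\<lambda>i. a i + b i)
       \<le> monomial n (\<lambda>_. 0) \<tau> * ising_sum n (?A \<tau>) (\<lambda>i. a i + b i + 0)"
      using abs_monomial[OF \<tau>, of b] by (intro mult_mono) (auto simp: monomial_def)
  qed
  also have "\<dots> = ising_sum n A (\<lambda>i. a i + b i) * ising_sum n A (\<lambda>_. 0)"
    by (rule ising_sum_mult[symmetric])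
  finally show ?thesis .
qed

text \<open>Correlations increase with the couplings, obtained without differentiation: after the
  change of variables the two sides have couplings A + B t and B + A t with t = 1 or t = -1, and the
  second dominates the absolute value of the first.\<close>

lemma ising_mono:
  assumes "\<And>X. X \<subseteq> {..<n} \<Longrightarrow> 0 \<le> A X" "\<And>X. X \<subseteq> {..<n} \<Longrightarrow> A X \<le> B X"
  shows "ising_sum n A a * ising_sum n B (\<lambda>_. 0) \<le> ising_sum n B a * ising_sum n A (\<lambda>_. 0)"
  unfolding ising_sum_mult
proof (rule sum_mono)
  fix \<tau> assume \<tau>: "\<tau> \<in> spin_configs n"
  have "ising_sum n (\<lambda>X. A X + B X * (\<Prod>i\<in>X. \<tau> i)) (\<lambda>i. a i + 0)
     \<le> ising_sum n (\<lambda>X. B X + A X * (\<Prod>i\<in>X. \<tau> i)) (\<lambda>i. a i + 0)"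
  proof (rule order_trans[OF abs_ge_self abs_ising_sum_le])
    fix X assume X: "X \<subseteq> {..<n}"
    have "\<bar>\<Prod>i\<in>X. \<tau> i\<bar> = 1" using abs_prod_spin[OF \<tau>] .
    then have "(\<Prod>i\<in>X. \<tau> i) = 1 \<or> (\<Prod>i\<in>X. \<tau> i) = -1" by linarith
    then show "\<bar>A X + B X * (\<Prod>i\<in>X. \<tau> i)\<bar> \<le> B X + A X * (\<Prod>i\<in>X. \<tau> i)"
      using assms[OF X] by auto
  qed
  then show "monomial n (\<lambda>_. 0) \<tau> * ising_sum n (\<lambda>X. A X + B X * (\<Prod>i\<in>X. \<tau> i)) (\<lambda>i. a i + 0)
    \<le> monomial n (\<lambda>_. 0) \<tau> * ising_sum n (\<lambda>X. B X + A X * (\<Prod>i\<in>X. \<tau> i)) (\<lambda>i. a i + 0)"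
    by (simp add: monomial_def)
qed

section \<open>Gibbs averages and their derivatives in the field\<close>

text \<open>The single-replica average. Replica averages of products over replicas are powers of it,
  so all estimates on k replicas reduce to it.\<close>

definition gibbs1 ::
  "nat \<Rightarrow> (nat set \<Rightarrow> real) \<Rightarrow> (nat \<Rightarrow> nat) \<Rightarrow> real \<Rightarrow> real \<Rightarrow> ((nat \<Rightarrow> real) \<Rightarrow> real) \<Rightarrow> real" where
  "gibbs1 n J \<tau> h0 h1 f =
    (\<Sum>\<sigma>\<in>spin_configs n. f \<sigma> * exp (- hamiltonian n J \<tau> h0 h1 \<sigma>)) / partition_fun n J \<tau> h0 h1"

lemma partition_fun_pos: "0 < partition_fun n J \<tau> h0 h1"
  unfolding partition_fun_def by (rule sum_pos2[where i="\<lambda>_. 1"]) auto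

lemma gibbs1_const [simp]: "gibbs1 n J \<tau> h0 h1 (\<lambda>_. c) = c"
  using partition_fun_pos[of n J \<tau> h0 h1]
  by (simp add: gibbs1_def sum_distrib_left[symmetric] partition_fun_def[symmetric])

lemma gibbs1_sum: "gibbs1 n J \<tau> h0 h1 (\<lambda>\<sigma>. \<Sum>i\<in>I. f i \<sigma>) = (\<Sum>i\<in>I. gibbs1 n J \<tau> h0 h1 (f i))"
  unfolding gibbs1_def sum_distrib_right by (subst sum.swap) (simp add: sum_divide_distrib)

lemma gibbs1_divide: "gibbs1 n J \<tau> h0 h1 (\<lambda>\<sigma>. f \<sigma> / c) = gibbs1 n J \<tau> h0 h1 f / c"
  by (simp add: gibbs1_def sum_divide_distrib field_simps)

lemma gibbs1_add: "gibbs1 n J \<tau> h0 h1 (\<lambda>\<sigma>. f \<sigma> + g \<sigma>) = gibbs1 n J \<tau> h0 h1 f + gibbs1 n J \<tau> h0 h1 g"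
  by (simp add: gibbs1_def sum.distrib ring_distribs add_divide_distrib)

lemma gibbs1_cmult: "gibbs1 n J \<tau> h0 h1 (\<lambda>\<sigma>. c * f \<sigma>) = c * gibbs1 n J \<tau> h0 h1 f"
  by (simp add: gibbs1_def sum_distrib_left mult.assoc)

lemma gibbs1_mono:
  assumes "\<And>\<sigma>. \<sigma> \<in> spin_configs n \<Longrightarrow> f \<sigma> \<le> g \<sigma>"
  shows "gibbs1 n J \<tau> h0 h1 f \<le> gibbs1 n J \<tau> h0 h1 g"
  using partition_fun_pos[of n J \<tau> h0 h1] assms unfolding gibbs1_def
  by (intro divide_right_mono sum_mono mult_right_mono) (auto intro: less_imp_le)

lemma abs_gibbs1_le:
  assumes "\<And>\<sigma>. \<sigma> \<in> spin_configs n \<Longrightarrow> \<bar>f \<sigma>\<bar> \<le> c"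
  shows "\<bar>gibbs1 n J \<tau> h0 h1 f\<bar> \<le> c"
  using gibbs1_mono[of n f "\<lambda>_. c" J \<tau> h0 h1] gibbs1_mono[of n "\<lambda>_. - c" f J \<tau> h0 h1] assms
  by (fastforce simp: abs_le_iff)

section \<open>Gibbs averages in Ising form and the GKS inequalities for them\<close>

text \<open>The external fields are couplings of the singletons.\<close>
definition couplings :: "nat \<Rightarrow> (nat set \<Rightarrow> real) \<Rightarrow> (nat \<Rightarrow> nat) \<Rightarrow> real \<Rightarrow> real \<Rightarrow> nat set \<Rightarrow> real" where
  "couplings n J \<tau> h0 h1 X = J X + (\<Sum>i<n. if X = {i} then h0 + h1 * real (\<tau> i) else 0)"

lemma hamiltonian_couplings:
  "- hamiltonian n J \<tau> h0 h1 \<sigma> = (\<Sum>X\<in>Pow {..<n}. couplings n J \<tau> h0 h1 X * (\<Prod>i\<in>X. \<sigma> i))"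
proof -
  have "(\<Sum>X\<in>Pow {..<n}. (\<Sum>i<n. if X = {i} then h0 + h1 * real (\<tau> i) else 0) * (\<Prod>i\<in>X. \<sigma> i))
      = (\<Sum>i<n. \<Sum>X\<in>Pow {..<n}. if X = {i} then (h0 + h1 * real (\<tau> i)) * \<sigma> i else 0)"
    unfolding sum_distrib_right by (subst sum.swap) (auto intro!: sum.cong)
  also have "\<dots> = (\<Sum>i<n. (h0 + h1 * real (\<tau> i)) * \<sigma> i)"
    by (intro sum.cong) (auto simp: sum.delta)
  finally show ?thesis
    by (simp add: hamiltonian_def couplings_def algebra_simps sum.distrib sum_distrib_left)
qed

lemma gibbs1_monomial:
  "gibbs1 n J \<tau> h0 h1 (monomial n a) =
    ising_sum n (couplings n J \<tau> h0 h1) a / ising_sum n (couplings n J \<tau> h0 h1) (\<lambda>_. 0)"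
  by (simp add: gibbs1_def partition_fun_def hamiltonian_couplings ising_sum_def monomial_def)

lemma ising_sum_0_pos: "0 < ising_sum n A (\<lambda>_. 0)"
  unfolding ising_sum_def by (rule sum_pos2[where i="\<lambda>_. 1"]) (auto simp: monomial_def)

lemma couplings_nonneg:
  assumes "\<forall>X\<in>Pow {..<n}. 0 \<le> J X" "0 \<le> h0" "0 \<le> h1" "X \<subseteq> {..<n}"
  shows "0 \<le> couplings n J \<tau> h0 h1 X"
  unfolding couplings_def using assms by (intro add_nonneg_nonneg sum_nonneg) auto

lemma couplings_mono:
  assumes "\<forall>X\<in>Pow {..<n}. J X \<le> J' X" "\<forall>i\<in>{..<n}. \<tau> i \<le> \<tau>' i" "0 \<le> h1" "X \<subseteq> {..<n}"
  shows "couplings n J \<tau> h0 h1 X \<le> couplings n J' \<tau>' h0 h1 X"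
  unfolding couplings_def using assms by (intro add_mono sum_mono) (auto intro: mult_left_mono)

lemma gibbs1_monomial_nonneg:
  assumes "\<forall>X\<in>Pow {..<n}. 0 \<le> J X" "0 \<le> h0" "0 \<le> h1"
  shows "0 \<le> gibbs1 n J \<tau> h0 h1 (monomial n a)"
  unfolding gibbs1_monomial
  by (intro divide_nonneg_pos ising_sum_0_pos ising_sum_nonneg couplings_nonneg assms)

lemma gibbs1_monomial_gks2:
  assumes "\<forall>X\<in>Pow {..<n}. 0 \<le> J X" "0 \<le> h0" "0 \<le> h1"
  shows "gibbs1 n J \<tau> h0 h1 (monomial n a) * gibbs1 n J \<tau> h0 h1 (monomial n b)
     \<le> gibbs1 n J \<tau> h0 h1 (\<lambda>\<sigma>. monomial n a \<sigma> * monomial n b \<sigma>)"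
proof -
  have "gibbs1 n J \<tau> h0 h1 (\<lambda>\<sigma>. monomial n a \<sigma> * monomial n b \<sigma>) =
      gibbs1 n J \<tau> h0 h1 (monomial n (\<lambda>i. a i + b i))"
    by (simp add: monomial_add[abs_def])
  then show ?thesis
    unfolding gibbs1_monomial
    using ising_sum_0_pos[of n "couplings n J \<tau> h0 h1"]
      ising_gks2[of n "couplings n J \<tau> h0 h1" a b] couplings_nonneg[OF assms]
    by (simp add: field_simps)
qed

lemma gibbs1_monomial_mono:
  assumes "\<forall>X\<in>Pow {..<n}. 0 \<le> J X" "0 \<le> h0" "0 \<le> h1"
    and "\<forall>X\<in>Pow {..<n}. J X \<le> J' X" "\<forall>i\<in>{..<n}. \<tau> i \<le> \<tau>' i"
  shows "gibbs1 n J \<tau> h0 h1 (monomial n a) \<le> gibbs1 n J' \<tau>' h0 h1 (monomial n a)"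
proof -
  have "ising_sum n (couplings n J \<tau> h0 h1) a * ising_sum n (couplings n J' \<tau>' h0 h1) (\<lambda>_. 0)
    \<le> ising_sum n (couplings n J' \<tau>' h0 h1) a * ising_sum n (couplings n J \<tau> h0 h1) (\<lambda>_. 0)"
    by (intro ising_mono couplings_nonneg couplings_mono assms)
  then show ?thesis
    unfolding gibbs1_monomial
    using ising_sum_0_pos[of n "couplings n J \<tau> h0 h1"] ising_sum_0_pos[of n "couplings n J' \<tau>' h0 h1"]
    by (simp add: field_simps)
qed

lemma gibbs1_site:
  "i < n \<Longrightarrow> gibbs1 n J \<tau> h0 h1 (\<lambda>\<sigma>. \<sigma> i) = gibbs1 n J \<tau> h0 h1 (monomial n (\<lambda>j. if j = i then 1 else 0))"
  by (rule arg_cong[of _ _ "gibbs1 n J \<tau> h0 h1"]) (simp add: fun_eq_iff monomial_single)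

lemma gibbs1_site_nonneg:
  assumes "\<forall>X\<in>Pow {..<n}. 0 \<le> J X" "0 \<le> h0" "0 \<le> h1" "i < n"
  shows "0 \<le> gibbs1 n J \<tau> h0 h1 (\<lambda>\<sigma>. \<sigma> i)"
  using gibbs1_monomial_nonneg[OF assms(1-3)] by (simp add: gibbs1_site assms(4))

lemma gibbs1_site_mono:
  assumes "\<forall>X\<in>Pow {..<n}. 0 \<le> J X" "0 \<le> h0" "0 \<le> h1"
    and "\<forall>X\<in>Pow {..<n}. J X \<le> J' X" "\<forall>i\<in>{..<n}. \<tau> i \<le> \<tau>' i" "i < n"
  shows "gibbs1 n J \<tau> h0 h1 (\<lambda>\<sigma>. \<sigma> i) \<le> gibbs1 n J' \<tau>' h0 h1 (\<lambda>\<sigma>. \<sigma> i)"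
  using gibbs1_monomial_mono[OF assms(1-5)] by (simp add: gibbs1_site assms(6))

lemma gibbs1_site_gks2:
  assumes "\<forall>X\<in>Pow {..<n}. 0 \<le> J X" "0 \<le> h0" "0 \<le> h1" "i < n" "j < n"
  shows "gibbs1 n J \<tau> h0 h1 (\<lambda>\<sigma>. \<sigma> i) * gibbs1 n J \<tau> h0 h1 (\<lambda>\<sigma>. \<sigma> j)
     \<le> gibbs1 n J \<tau> h0 h1 (\<lambda>\<sigma>. \<sigma> i * \<sigma> j)"
  using gibbs1_monomial_gks2[OF assms(1-3), of \<tau> "\<lambda>k. if k = i then 1 else 0" "\<lambda>k. if k = j then 1 else 0"]
  by (simp add: gibbs1_site assms(4,5) monomial_single)

lemma abs_gibbs1_site_le: "\<bar>gibbs1 n J \<tau> h0 h1 (\<lambda>\<sigma>. \<sigma> i)\<bar> \<le> 1"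
  by (rule abs_gibbs1_le) (simp add: abs_spin)

lemma abs_gibbs1_sites_le: "\<bar>gibbs1 n J \<tau> h0 h1 (\<lambda>\<sigma>. \<sigma> i * \<sigma> j)\<bar> \<le> 1"
  by (rule abs_gibbs1_le) (simp add: abs_spin abs_mult)

section \<open>Replica averages and multi-overlaps\<close>

lemma replica_configsD: "s \<in> replica_configs n k \<Longrightarrow> r < k \<Longrightarrow> s r \<in> spin_configs n"
  by (auto simp: replica_configs_def)

text \<open>Independence of the replicas: a sum over the product of configuration spaces of a
  product is the product of the sums.\<close>

lemma gibbs_prod:
  "gibbs n J \<tau> h0 h1 k (\<lambda>s. \<Prod>r<k. g (s r)) = gibbs1 n J \<tau> h0 h1 g ^ k"
proof -
  have "(\<Sum>s\<in>replica_configs n k. (\<Prod>r<k. g (s r)) * (\<Prod>r<k. exp (- hamiltonian n J \<tau> h0 h1 (s r))))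
      = (\<Prod>r<k. \<Sum>\<sigma>\<in>spin_configs n. g \<sigma> * exp (- hamiltonian n J \<tau> h0 h1 \<sigma>))"
    unfolding replica_configs_def by (subst prod_sum_PiE) (auto simp: prod.distrib)
  then show ?thesis
    by (simp add: gibbs_def gibbs1_def power_divide)
qed

lemma gibbs_const [simp]: "gibbs n J \<tau> h0 h1 k (\<lambda>_. c) = c"
proof -
  have "gibbs n J \<tau> h0 h1 k (\<lambda>_. 1) = 1"
    using gibbs_prod[of n J \<tau> h0 h1 k "\<lambda>_. 1"] by simp
  moreover have "gibbs n J \<tau> h0 h1 k (\<lambda>_. c) = c * gibbs n J \<tau> h0 h1 k (\<lambda>_. 1)"
    by (simp add: gibbs_def sum_distrib_left)
  ultimately show ?thesis by simp
qed

lemma gibbs_sum: "gibbs n J \<tau> h0 h1 k (\<lambda>s. \<Sum>i\<in>I. f i s) = (\<Sum>i\<in>I. gibbs n J \<tau> h0 h1 k (f i))"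
  unfolding gibbs_def sum_distrib_right by (subst sum.swap) (simp add: sum_divide_distrib)

lemma gibbs_add: "gibbs n J \<tau> h0 h1 k (\<lambda>s. f s + g s) = gibbs n J \<tau> h0 h1 k f + gibbs n J \<tau> h0 h1 k g"
  by (simp add: gibbs_def sum.distrib ring_distribs add_divide_distrib)

lemma gibbs_cmult: "gibbs n J \<tau> h0 h1 k (\<lambda>s. c * f s) = c * gibbs n J \<tau> h0 h1 k f"
  by (simp add: gibbs_def sum_distrib_left mult.assoc)

lemma gibbs_mono:
  assumes "\<And>s. s \<in> replica_configs n k \<Longrightarrow> f s \<le> g s"
  shows "gibbs n J \<tau> h0 h1 k f \<le> gibbs n J \<tau> h0 h1 k g"
  using partition_fun_pos[of n J \<tau> h0 h1] assms unfolding gibbs_def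
  by (intro divide_right_mono sum_mono mult_right_mono prod_nonneg) (auto intro: less_imp_le)

lemma gibbs_overlap:
  "gibbs n J \<tau> h0 h1 k (overlap n k) = (\<Sum>i<n. gibbs1 n J \<tau> h0 h1 (\<lambda>\<sigma>. \<sigma> i) ^ k) / real n"
  unfolding overlap_def gibbs_cmult gibbs_sum
  using gibbs_prod[of n J \<tau> h0 h1 k "\<lambda>\<sigma>. \<sigma> i" for i] by simp

lemma gibbs_overlap_square:
  "gibbs n J \<tau> h0 h1 k (\<lambda>s. overlap n k s ^ 2) =
    (\<Sum>i<n. \<Sum>j<n. gibbs1 n J \<tau> h0 h1 (\<lambda>\<sigma>. \<sigma> i * \<sigma> j) ^ k) / real n ^ 2"
proof -
  have "overlap n k s ^ 2 = (1 / real n ^ 2) * (\<Sum>i<n. \<Sum>j<n. \<Prod>r<k. s r i * s r j)" for s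
    by (simp add: overlap_def power2_eq_square sum_product prod.distrib)
  then show ?thesis
    by (simp only: gibbs_cmult gibbs_sum) (simp add: gibbs_prod[of n J \<tau> h0 h1 k "\<lambda>\<sigma>. \<sigma> i * \<sigma> j" for i j])
qed

text \<open>The field \<open>h0\<close> comes last, so that a partial application is a function of
  the field, ready to be differentiated.\<close>

definition magnetization :: "nat \<Rightarrow> (nat set \<Rightarrow> real) \<Rightarrow> (nat \<Rightarrow> nat) \<Rightarrow> real \<Rightarrow> real \<Rightarrow> real" where
  "magnetization n J \<tau> h1 h0 = gibbs1 n J \<tau> h0 h1 (\<lambda>\<sigma>. (\<Sum>i<n. \<sigma> i) / real n)"

text \<open>The Gibbs variance of the magnetization density at fixed disorder.\<close>

definition thermal_var :: "nat \<Rightarrow> (nat set \<Rightarrow> real) \<Rightarrow> (nat \<Rightarrow> nat) \<Rightarrow> real \<Rightarrow> real \<Rightarrow> real" where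
  "thermal_var n J \<tau> h1 h0 =
    gibbs1 n J \<tau> h0 h1 (\<lambda>\<sigma>. ((\<Sum>i<n. \<sigma> i) / real n) ^ 2) - magnetization n J \<tau> h1 h0 ^ 2"

lemma magnetization_sites:
  "magnetization n J \<tau> h1 h0 = (\<Sum>i<n. gibbs1 n J \<tau> h0 h1 (\<lambda>\<sigma>. \<sigma> i)) / real n"
  by (simp add: magnetization_def gibbs1_divide gibbs1_sum)

lemma thermal_var_sites:
  "thermal_var n J \<tau> h1 h0 = (\<Sum>i<n. \<Sum>j<n. gibbs1 n J \<tau> h0 h1 (\<lambda>\<sigma>. \<sigma> i * \<sigma> j)
     - gibbs1 n J \<tau> h0 h1 (\<lambda>\<sigma>. \<sigma> i) * gibbs1 n J \<tau> h0 h1 (\<lambda>\<sigma>. \<sigma> j)) / real n ^ 2"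
proof -
  have "gibbs1 n J \<tau> h0 h1 (\<lambda>\<sigma>. ((\<Sum>i<n. \<sigma> i) / real n) ^ 2) =
      (\<Sum>i<n. \<Sum>j<n. gibbs1 n J \<tau> h0 h1 (\<lambda>\<sigma>. \<sigma> i * \<sigma> j)) / real n ^ 2"
    by (simp add: power_divide power2_eq_square[of "sum _ _"] sum_product gibbs1_divide gibbs1_sum)
  then show ?thesis
    unfolding thermal_var_def magnetization_sites
    by (simp add: power_divide sum_product power2_eq_square[of "sum _ _"] sum_subtractf diff_divide_distrib)
qed

lemma abs_magnetization_le:
  assumes "0 < n" shows "\<bar>magnetization n J \<tau> h1 h0\<bar> \<le> 1"
  unfolding magnetization_def
proof (rule abs_gibbs1_le)
  fix \<sigma> assume "\<sigma> \<in> spin_configs n"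
  then have "\<bar>\<Sum>i<n. \<sigma> i\<bar> \<le> real n"
    using sum_abs[of \<sigma> "{..<n}"] by (simp add: abs_spin)
  then show "\<bar>(\<Sum>i<n. \<sigma> i) / real n\<bar> \<le> 1" using assms by (simp add: field_simps)
qed

lemma thermal_var_nonneg: "0 \<le> thermal_var n J \<tau> h1 h0"
proof -
  define m where "m = magnetization n J \<tau> h1 h0"
  let ?q = "\<lambda>\<sigma>::nat \<Rightarrow> real. (\<Sum>i<n. \<sigma> i) / real n"
  have "0 \<le> gibbs1 n J \<tau> h0 h1 (\<lambda>\<sigma>. (?q \<sigma> - m) ^ 2)"
    using gibbs1_mono[of n "\<lambda>_. 0" "\<lambda>\<sigma>. (?q \<sigma> - m) ^ 2" J \<tau> h0 h1] by simp
  also have "(\<lambda>\<sigma>. (?q \<sigma> - m) ^ 2) = (\<lambda>\<sigma>. ?q \<sigma> ^ 2 + (- 2 * m) * ?q \<sigma> + m ^ 2 * 1)"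
    by (auto simp: power2_eq_square algebra_simps)
  also have "gibbs1 n J \<tau> h0 h1 \<dots> = thermal_var n J \<tau> h1 h0"
    by (simp only: gibbs1_add gibbs1_cmult gibbs1_const)
      (simp add: thermal_var_def magnetization_def[symmetric] m_def[symmetric] power2_eq_square)
  finally show ?thesis .
qed

lemma thermal_var_le:
  assumes "0 < n" shows "thermal_var n J \<tau> h1 h0 \<le> 1"
proof -
  have "\<bar>gibbs1 n J \<tau> h0 h1 (\<lambda>\<sigma>. ((\<Sum>i<n. \<sigma> i) / real n) ^ 2)\<bar> \<le> 1"
  proof (rule abs_gibbs1_le)
    fix \<sigma> assume "\<sigma> \<in> spin_configs n"
    then have "\<bar>\<Sum>i<n. \<sigma> i\<bar> \<le> real n"
      using sum_abs[of \<sigma> "{..<n}"] by (simp add: abs_spin)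
    then have "\<bar>(\<Sum>i<n. \<sigma> i) / real n\<bar> \<le> 1" using assms by (simp add: field_simps)
    then show "\<bar>((\<Sum>i<n. \<sigma> i) / real n) ^ 2\<bar> \<le> 1" by (simp only: abs_power2 abs_square_le_1)
  qed
  then show ?thesis unfolding thermal_var_def using zero_le_power2[of "magnetization n J \<tau> h1 h0"] by linarith
qed

lemma power_diff_le:
  fixes x y :: real
  assumes "0 \<le> y" "y \<le> x" "x \<le> 1"
  shows "x ^ k - y ^ k \<le> real k * (x - y)"
  using norm_power_diff[of x y k] assms by simp

text \<open>Both terms are double sums over sites of k-th powers of x =
  \<open>?g (\<lambda>\<sigma>. \<sigma> i * \<sigma> j)\<close> and of the product y of the two
  local magnetizations. GKS gives 0 \<le> y \<le> x \<le> 1, where the difference of the powers is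
  at most k (x - y).\<close>

lemma gibbs_overlap_variance_le:
  assumes "\<forall>X\<in>Pow {..<n}. 0 \<le> J X" "0 \<le> h0" "0 \<le> h1"
  shows "gibbs n J \<tau> h0 h1 k (\<lambda>s. overlap n k s ^ 2) - gibbs n J \<tau> h0 h1 k (overlap n k) ^ 2
    \<le> real k * thermal_var n J \<tau> h1 h0"
proof -
  let ?g = "gibbs1 n J \<tau> h0 h1"
  have "gibbs n J \<tau> h0 h1 k (\<lambda>s. overlap n k s ^ 2) - gibbs n J \<tau> h0 h1 k (overlap n k) ^ 2
    = (\<Sum>i<n. \<Sum>j<n. ?g (\<lambda>\<sigma>. \<sigma> i * \<sigma> j) ^ k - (?g (\<lambda>\<sigma>. \<sigma> i) * ?g (\<lambda>\<sigma>. \<sigma> j)) ^ k) / real n ^ 2"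
    unfolding gibbs_overlap gibbs_overlap_square
    by (simp add: power_divide power2_eq_square[of "sum _ _"] sum_product sum_subtractf
        diff_divide_distrib power_mult_distrib)
  also have "\<dots> \<le> (\<Sum>i<n. \<Sum>j<n. real k * (?g (\<lambda>\<sigma>. \<sigma> i * \<sigma> j) - ?g (\<lambda>\<sigma>. \<sigma> i) * ?g (\<lambda>\<sigma>. \<sigma> j))) / real n ^ 2"
    using abs_gibbs1_sites_le[of n J \<tau> h0 h1]
    by (intro divide_right_mono sum_mono power_diff_le mult_nonneg_nonneg gibbs1_site_nonneg
        gibbs1_site_gks2 assms) (auto simp: abs_le_iff)
  also have "\<dots> = real k * thermal_var n J \<tau> h1 h0"
    by (simp add: thermal_var_sites sum_distrib_left)
  finally show ?thesis .
qed

section \<open>Derivatives in the uniform field\<close>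

lemma DERIV_gibbs_sum:
  "((\<lambda>h0. \<Sum>\<sigma>\<in>spin_configs n. f \<sigma> * exp (- hamiltonian n J \<tau> h0 h1 \<sigma>)) has_real_derivative
    (\<Sum>\<sigma>\<in>spin_configs n. f \<sigma> * (\<Sum>i<n. \<sigma> i) * exp (- hamiltonian n J \<tau> h0 h1 \<sigma>))) (at h0)"
  by (rule DERIV_sum) (auto simp: hamiltonian_def intro!: derivative_eq_intros)

lemma DERIV_partition_fun:
  "((\<lambda>h0. partition_fun n J \<tau> h0 h1) has_real_derivative
    (\<Sum>\<sigma>\<in>spin_configs n. (\<Sum>i<n. \<sigma> i) * exp (- hamiltonian n J \<tau> h0 h1 \<sigma>))) (at h0)"
  using DERIV_gibbs_sum[where f="\<lambda>_. 1"] by (simp add: partition_fun_def)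

lemma DERIV_pressure:
  "((\<lambda>h0. pressure n J \<tau> h0 h1) has_real_derivative magnetization n J \<tau> h1 h0) (at h0)"
  unfolding pressure_def magnetization_def gibbs1_divide
  using DERIV_cdivide[OF DERIV_chain2[OF DERIV_ln[OF partition_fun_pos] DERIV_partition_fun], of n J \<tau> h1 "real n" h0]
  by (simp add: gibbs1_def field_simps)

lemma DERIV_magnetization:
  assumes "0 < n"
  shows "(magnetization n J \<tau> h1 has_real_derivative real n * thermal_var n J \<tau> h1 h0) (at h0)"
proof -
  let ?e = "\<lambda>\<sigma>. exp (- hamiltonian n J \<tau> h0 h1 \<sigma>)"
  \<comment> \<open>Quotient rule with unnormalized averages: for the density q of the total spin M
    = n q, \<open>A\<close>, \<open>B\<close> and \<open>S\<close> are those of q M, q and M. The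
    factor n in the derivative comes from M = n q.\<close>
  define A where "A = (\<Sum>\<sigma>\<in>spin_configs n. (\<Sum>i<n. \<sigma> i) / real n * (\<Sum>i<n. \<sigma> i) * ?e \<sigma>)"
  define B where "B = (\<Sum>\<sigma>\<in>spin_configs n. (\<Sum>i<n. \<sigma> i) / real n * ?e \<sigma>)"
  define S where "S = (\<Sum>\<sigma>\<in>spin_configs n. (\<Sum>i<n. \<sigma> i) * ?e \<sigma>)"
  define Z where "Z = partition_fun n J \<tau> h0 h1"
  have Z: "Z > 0" unfolding Z_def by (rule partition_fun_pos)
  have "((\<lambda>h0. (\<Sum>\<sigma>\<in>spin_configs n. (\<Sum>i<n. \<sigma> i) / real n * exp (- hamiltonian n J \<tau> h0 h1 \<sigma>))
      / partition_fun n J \<tau> h0 h1) has_real_derivative (A * Z - B * S) / (Z * Z)) (at h0)"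
    unfolding A_def B_def S_def Z_def
    by (intro DERIV_divide DERIV_gibbs_sum DERIV_partition_fun) (simp add: partition_fun_pos less_imp_neq[symmetric])
  then have *: "(magnetization n J \<tau> h1 has_real_derivative (A * Z - B * S) / (Z * Z)) (at h0)"
    by (simp only: magnetization_def[abs_def] gibbs1_def[abs_def])
  have "real n * gibbs1 n J \<tau> h0 h1 (\<lambda>\<sigma>. ((\<Sum>i<n. \<sigma> i) / real n) ^ 2) = A / Z"
    unfolding gibbs1_def times_divide_eq_right sum_distrib_left A_def Z_def
    using assms by (intro arg_cong2[of _ _ _ _ "(/)"] sum.cong refl)
      (simp add: power2_eq_square sum_distrib_left[symmetric] sum_divide_distrib[symmetric])
  moreover have "magnetization n J \<tau> h1 h0 = B / Z"
    by (simp add: magnetization_def gibbs1_def B_def Z_def)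
  moreover have "real n * magnetization n J \<tau> h1 h0 = S / Z"
    unfolding magnetization_def gibbs1_divide using assms by (simp add: gibbs1_def S_def Z_def)
  ultimately have "real n * thermal_var n J \<tau> h1 h0 = A / Z - (S / Z) * (B / Z)"
    unfolding thermal_var_def power2_eq_square[of "magnetization _ _ _ _ _"]
    by (metis (no_types) mult.assoc right_diff_distrib)
  also have "\<dots> = (A * Z - B * S) / (Z * Z)"
    using Z by (simp add: field_simps)
  finally show ?thesis using * by simp
qed

text \<open>The derivative is n times a variance. As the magnetization is itself the derivative of
  the pressure, this expresses convexity of the pressure in the field.\<close>

lemma magnetization_mono:
  assumes "0 < n" "x \<le> y" shows "magnetization n J \<tau> h1 x \<le> magnetization n J \<tau> h1 y"
  using DERIV_magnetization[OF assms(1), of J \<tau> h1] thermal_var_nonneg[of n J \<tau> h1]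
  by (intro DERIV_nonneg_imp_nondecreasing[OF assms(2)]) (meson mult_nonneg_nonneg of_nat_0_le_iff)

section \<open>Harris inequality\<close>

text \<open>Association in the sense of Esary, Proschan and Walkup, restricted to bounded functions.\<close>
definition associated :: "'a measure \<Rightarrow> ('a \<Rightarrow> 'a \<Rightarrow> bool) \<Rightarrow> bool" where
  "associated M le \<longleftrightarrow> (\<forall>f g :: 'a \<Rightarrow> real.
     f \<in> borel_measurable M \<longrightarrow> g \<in> borel_measurable M \<longrightarrow>
     (\<exists>B. \<forall>x\<in>space M. \<bar>f x\<bar> \<le> B) \<longrightarrow> (\<exists>B. \<forall>x\<in>space M. \<bar>g x\<bar> \<le> B) \<longrightarrow>
     (\<forall>x\<in>space M. \<forall>y\<in>space M. le x y \<longrightarrow> f x \<le> f y) \<longrightarrow>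
     (\<forall>x\<in>space M. \<forall>y\<in>space M. le x y \<longrightarrow> g x \<le> g y) \<longrightarrow>
     (\<integral>x. f x \<partial>M) * (\<integral>x. g x \<partial>M) \<le> (\<integral>x. f x * g x \<partial>M))"

lemma associatedD:
  fixes f g :: "'a \<Rightarrow> real"
  assumes "associated M le" "f \<in> borel_measurable M" "g \<in> borel_measurable M"
    and "\<And>x. x \<in> space M \<Longrightarrow> \<bar>f x\<bar> \<le> B" "\<And>x. x \<in> space M \<Longrightarrow> \<bar>g x\<bar> \<le> B'"
    and "\<And>x y. x \<in> space M \<Longrightarrow> y \<in> space M \<Longrightarrow> le x y \<Longrightarrow> f x \<le> f y"
    and "\<And>x y. x \<in> space M \<Longrightarrow> y \<in> space M \<Longrightarrow> le x y \<Longrightarrow> g x \<le> g y"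
  shows "(\<integral>x. f x \<partial>M) * (\<integral>x. g x \<partial>M) \<le> (\<integral>x. f x * g x \<partial>M)"
proof -
  have "\<exists>B. \<forall>x\<in>space M. \<bar>f x\<bar> \<le> B" "\<exists>B. \<forall>x\<in>space M. \<bar>g x\<bar> \<le> B"
    using assms(4,5) by blast+
  then show ?thesis
    using assms(1-3,6,7) unfolding associated_def by blast
qed

lemma (in prob_space) integrable_bounded:
  fixes f :: "'a \<Rightarrow> real"
  assumes "f \<in> borel_measurable M" "\<And>x. x \<in> space M \<Longrightarrow> \<bar>f x\<bar> \<le> B"
  shows "integrable M f"
  using assms by (intro integrable_const_bound[of f B]) auto

lemma (in prob_space) abs_expectation_le:
  fixes f :: "'a \<Rightarrow> real"
  assumes "\<And>x. x \<in> space M \<Longrightarrow> \<bar>f x\<bar> \<le> B"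
  shows "\<bar>expectation f\<bar> \<le> B"
proof (cases "integrable M f")
  case True
  then have "\<bar>expectation f\<bar> \<le> expectation (\<lambda>x. \<bar>f x\<bar>)" by simp
  also have "\<dots> \<le> expectation (\<lambda>_. B)"
    by (rule integral_mono) (use True assms in auto)
  finally show ?thesis by (simp add: prob_space)
next
  \<comment> \<open>A Bochner integral that does not exist has value 0, and \<open>B\<close> is
    nonnegative because the space is nonempty.\<close>
  case False
  obtain x where "x \<in> space M" using not_empty by blast
  then have "0 \<le> B" using assms[of x] by linarith
  then show ?thesis using False by (simp add: not_integrable_integral_eq)
qed

text \<open>Chebyshev's inequality: integrate \<open>(f x - f y) * (g x - g y) \<ge> 0\<close> over both variables.\<close>
lemma associated_linorder:
  fixes M :: "'a :: linorder measure"
  assumes "prob_space M"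
  shows "associated M (\<le>)"
  unfolding associated_def
proof (intro allI impI)
  interpret prob_space M by fact
  fix f g :: "'a \<Rightarrow> real"
  assume meas [measurable]: "f \<in> borel_measurable M" "g \<in> borel_measurable M"
    and bdf: "\<exists>B. \<forall>x\<in>space M. \<bar>f x\<bar> \<le> B" and bdg: "\<exists>B. \<forall>x\<in>space M. \<bar>g x\<bar> \<le> B"
    and mono: "\<forall>x\<in>space M. \<forall>y\<in>space M. x \<le> y \<longrightarrow> f x \<le> f y"
      "\<forall>x\<in>space M. \<forall>y\<in>space M. x \<le> y \<longrightarrow> g x \<le> g y"
  obtain B B' where B: "\<forall>x\<in>space M. \<bar>f x\<bar> \<le> B" "\<forall>x\<in>space M. \<bar>g x\<bar> \<le> B'"
    using bdf bdg by blast
  have [simp]: "integrable M f" "integrable M g"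
    using B by (auto intro!: integrable_bounded)
  have [simp]: "integrable M (\<lambda>x. f x * g x)"
  proof (rule integrable_bounded[where B="B * B'"])
    show "\<bar>f x * g x\<bar> \<le> B * B'" if "x \<in> space M" for x
      using B that unfolding abs_mult by (intro mult_mono) (auto intro: order_trans[OF abs_ge_zero])
  qed simp
  have "0 \<le> f x * g x - f x * expectation g - g x * expectation f + expectation (\<lambda>y. f y * g y)"
    if x: "x \<in> space M" for x
  proof -
    have "0 \<le> expectation (\<lambda>y. (f x - f y) * (g x - g y))"
    proof (rule integral_nonneg_AE, rule AE_I2)
      fix y assume "y \<in> space M"
      \<comment> \<open>In a linear order x and y are comparable, so the two differences have the
        same sign.\<close>
      then show "0 \<le> (f x - f y) * (g x - g y)"
        using mono x by (cases "x \<le> y") (auto simp: zero_le_mult_iff)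
    qed
    also have "\<dots> = expectation (\<lambda>y. f x * g x - f x * g y - g x * f y + f y * g y)"
      by (simp add: algebra_simps)
    also have "\<dots> = f x * g x - f x * expectation g - g x * expectation f + expectation (\<lambda>y. f y * g y)"
      by (simp add: prob_space)
    finally show ?thesis .
  qed
  then have "0 \<le> expectation (\<lambda>x. f x * g x - f x * expectation g - g x * expectation f
      + expectation (\<lambda>y. f y * g y))"
    by (intro integral_nonneg_AE AE_I2)
  also have "\<dots> = 2 * (expectation (\<lambda>x. f x * g x) - expectation f * expectation g)"
    by (simp add: prob_space)
  finally show "expectation f * expectation g \<le> expectation (\<lambda>x. f x * g x)" by simp
qed

text \<open>Condition on the first coordinate: association of \<open>N\<close> bounds the product of
  the partial integrals \<open>F\<close> and \<open>G\<close> by the partial integral of the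
  product, and association of \<open>M\<close> then applies to \<open>F\<close> and
  \<open>G\<close>. Reflexivity of the orders allows one coordinate to be moved at a time.\<close>

lemma associated_pair:
  assumes "prob_space M" "prob_space N" "associated M le1" "associated N le2"
    and refl: "\<And>x. le1 x x" "\<And>y. le2 y y"
  shows "associated (M \<Otimes>\<^sub>M N) (\<lambda>x y. le1 (fst x) (fst y) \<and> le2 (snd x) (snd y))"
  unfolding associated_def
proof (intro allI impI)
  interpret M: prob_space M by fact
  interpret N: prob_space N by fact
  interpret P: pair_prob_space M N ..
  fix f g :: "'a \<times> 'b \<Rightarrow> real"
  assume meas [measurable]: "f \<in> borel_measurable (M \<Otimes>\<^sub>M N)" "g \<in> borel_measurable (M \<Otimes>\<^sub>M N)"
    and bdf: "\<exists>B. \<forall>x\<in>space (M \<Otimes>\<^sub>M N). \<bar>f x\<bar> \<le> B" and bdg: "\<exists>B. \<forall>x\<in>space (M \<Otimes>\<^sub>M N). \<bar>g x\<bar> \<le> B"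
    and mono: "\<forall>x\<in>space (M \<Otimes>\<^sub>M N). \<forall>y\<in>space (M \<Otimes>\<^sub>M N).
        le1 (fst x) (fst y) \<and> le2 (snd x) (snd y) \<longrightarrow> f x \<le> f y"
      "\<forall>x\<in>space (M \<Otimes>\<^sub>M N). \<forall>y\<in>space (M \<Otimes>\<^sub>M N).
        le1 (fst x) (fst y) \<and> le2 (snd x) (snd y) \<longrightarrow> g x \<le> g y"
  obtain B B' where B: "\<And>x y. x \<in> space M \<Longrightarrow> y \<in> space N \<Longrightarrow> \<bar>f (x, y)\<bar> \<le> B"
    "\<And>x y. x \<in> space M \<Longrightarrow> y \<in> space N \<Longrightarrow> \<bar>g (x, y)\<bar> \<le> B'"
    using bdf bdg by (force simp: space_pair_measure)
  have BB: "\<bar>f (x, y) * g (x, y)\<bar> \<le> B * B'" if "x \<in> space M" "y \<in> space N" for x y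
    using B[OF that] unfolding abs_mult by (intro mult_mono) (auto intro: order_trans[OF abs_ge_zero])
  have int: "integrable (M \<Otimes>\<^sub>M N) f" "integrable (M \<Otimes>\<^sub>M N) g" "integrable (M \<Otimes>\<^sub>M N) (\<lambda>x. f x * g x)"
    using B BB by (auto intro!: P.integrable_bounded simp: space_pair_measure)
  define F where "F x = (\<integral>y. f (x, y) \<partial>N)" for x
  define G where "G x = (\<integral>y. g (x, y) \<partial>N)" for x
  have [measurable]: "F \<in> borel_measurable M" "G \<in> borel_measurable M"
    unfolding F_def G_def by measurable
  have Fb: "\<bar>F x\<bar> \<le> B" "\<bar>G x\<bar> \<le> B'" if "x \<in> space M" for x
    unfolding F_def G_def using that B by (auto intro!: N.abs_expectation_le)
  have inner: "F x * G x \<le> (\<integral>y. f (x, y) * g (x, y) \<partial>N)" if x: "x \<in> space M" for x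
    unfolding F_def G_def
  proof (rule associatedD[OF assms(4)])
    show "f (x, y) \<le> f (x, y')" "g (x, y) \<le> g (x, y')"
      if "y \<in> space N" "y' \<in> space N" "le2 y y'" for y y'
      using mono refl x that by (auto simp: space_pair_measure)
  qed (use x B in auto)
  have Fmono: "F x \<le> F x'" "G x \<le> G x'"
    if "x \<in> space M" "x' \<in> space M" "le1 x x'" for x x'
  proof -
    have "integrable N (\<lambda>y. f (z, y))" "integrable N (\<lambda>y. g (z, y))" if "z \<in> space M" for z
      using that B by (auto intro!: N.integrable_bounded)
    then show "F x \<le> F x'" "G x \<le> G x'"
      unfolding F_def G_def using that mono refl
      by (auto intro!: integral_mono simp: space_pair_measure)
  qed
  have "(\<integral>z. f z \<partial>(M \<Otimes>\<^sub>M N)) * (\<integral>z. g z \<partial>(M \<Otimes>\<^sub>M N)) = (\<integral>x. F x \<partial>M) * (\<integral>x. G x \<partial>M)"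
    unfolding F_def G_def using P.integral_fst'[OF int(1)] P.integral_fst'[OF int(2)] by simp
  also have "\<dots> \<le> (\<integral>x. F x * G x \<partial>M)"
    by (rule associatedD[OF assms(3)]) (use Fb Fmono in auto)
  also have "\<dots> \<le> (\<integral>x. (\<integral>y. f (x, y) * g (x, y) \<partial>N) \<partial>M)"
  proof (rule integral_mono)
    show "integrable M (\<lambda>x. F x * G x)"
    proof (rule M.integrable_bounded[where B="B * B'"])
      show "\<bar>F x * G x\<bar> \<le> B * B'" if "x \<in> space M" for x
        using Fb[OF that] unfolding abs_mult by (intro mult_mono) (auto intro: order_trans[OF abs_ge_zero])
    qed simp
    show "integrable M (\<lambda>x. \<integral>y. f (x, y) * g (x, y) \<partial>N)"
      using P.integrable_fst'[OF int(3)] by simp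
  qed (rule inner)
  also have "\<dots> = (\<integral>z. f z * g z \<partial>(M \<Otimes>\<^sub>M N))"
    using P.integral_fst'[OF int(3)] by simp
  finally show "(\<integral>z. f z \<partial>(M \<Otimes>\<^sub>M N)) * (\<integral>z. g z \<partial>(M \<Otimes>\<^sub>M N)) \<le> (\<integral>z. f z * g z \<partial>(M \<Otimes>\<^sub>M N))" .
qed

text \<open>Nondecreasing functions composed with the monotone map \<open>T\<close> are
  nondecreasing, so the inequality is pulled back to \<open>M\<close>.\<close>

lemma associated_distr:
  assumes T [measurable]: "T \<in> measurable M N" and "associated M le"
    and mono: "\<And>x y. x \<in> space M \<Longrightarrow> y \<in> space M \<Longrightarrow> le x y \<Longrightarrow> le' (T x) (T y)"
  shows "associated (distr M N T) le'"
  unfolding associated_def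
proof (intro allI impI)
  fix f g :: "'b \<Rightarrow> real"
  assume "f \<in> borel_measurable (distr M N T)" "g \<in> borel_measurable (distr M N T)"
    and bd: "\<exists>B. \<forall>x\<in>space (distr M N T). \<bar>f x\<bar> \<le> B" "\<exists>B. \<forall>x\<in>space (distr M N T). \<bar>g x\<bar> \<le> B"
    and m: "\<forall>x\<in>space (distr M N T). \<forall>y\<in>space (distr M N T). le' x y \<longrightarrow> f x \<le> f y"
       "\<forall>x\<in>space (distr M N T). \<forall>y\<in>space (distr M N T). le' x y \<longrightarrow> g x \<le> g y"
  then have [measurable]: "f \<in> borel_measurable N" "g \<in> borel_measurable N" by auto
  obtain B B' where B: "\<forall>x\<in>space N. \<bar>f x\<bar> \<le> B" "\<forall>x\<in>space N. \<bar>g x\<bar> \<le> B'"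
    using bd by auto
  have sp: "T x \<in> space N" if "x \<in> space M" for x
    using T that by (rule measurable_space)
  show "(\<integral>x. f x \<partial>distr M N T) * (\<integral>x. g x \<partial>distr M N T) \<le> (\<integral>x. f x * g x \<partial>distr M N T)"
    by (simp add: integral_distr, rule associatedD[OF assms(2)])
       (use B sp m mono in auto)
qed

text \<open>One coordinate is added at a time: a linearly ordered factor is associated by Chebyshev,
  pairs preserve association, and the map \<open>X(i := x)\<close> carries the pair law to the
  product law. The empty product is a one-point space.\<close>

theorem harris_PiM:
  fixes M :: "'i \<Rightarrow> 'a :: linorder measure"
  assumes "finite I" "\<And>i. i \<in> I \<Longrightarrow> prob_space (M i)"
  shows "associated (PiM I M) (\<lambda>x y. \<forall>i\<in>I. x i \<le> y i)"
  using assms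
proof (induction I rule: finite_induct)
  case empty
  interpret prob_space "PiM {} M" by (rule prob_space_PiM) simp
  show ?case
    unfolding associated_def PiM_empty
    by (auto simp: lebesgue_integral_count_space_finite)
next
  case (insert i I)
  have "associated (M i \<Otimes>\<^sub>M PiM I M) (\<lambda>x y. fst x \<le> fst y \<and> (\<forall>j\<in>I. snd x j \<le> snd y j))"
    using insert by (intro associated_pair associated_linorder prob_space_PiM) auto
  then have "associated (distr (M i \<Otimes>\<^sub>M PiM I M) (PiM (insert i I) M) (\<lambda>(x, X). X(i := x)))
      (\<lambda>x y. \<forall>j\<in>insert i I. x j \<le> y j)"
    by (rule associated_distr[rotated]) auto
  also have "distr (M i \<Otimes>\<^sub>M PiM I M) (PiM (insert i I) M) (\<lambda>(x, X). X(i := x)) = PiM (insert i I) M"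
    using insert by (intro distr_pair_PiM_eq_PiM) auto
  finally show ?case .
qed

section \<open>Derivatives of random convex functions\<close>

lemma finite_measure_restrict_interval: "finite_measure (restrict_space lborel {a..b :: real})"
  by (rule finite_measureI) (simp add: space_restrict_space emeasure_restrict_space emeasure_lborel_Icc_eq)

lemma integral_restrict_interval:
  fixes f :: "real \<Rightarrow> real"
  assumes "a \<le> b" "(f has_integral I) {a..b}" "continuous_on {a..b} f"
  shows "integrable (restrict_space lborel {a..b}) f"
    and "(\<integral>x. f x \<partial>restrict_space lborel {a..b}) = I"
proof -
  have "set_integrable lborel {a..b} f"
    by (rule borel_integrable_atLeastAtMost') fact
  then show "integrable (restrict_space lborel {a..b}) f"
    by (subst integrable_restrict_space) (auto simp: set_integrable_def)
  have "(\<integral>x. f x \<partial>restrict_space lborel {a..b}) = (LINT x:{a..b}|lborel. f x)"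
    by (subst integral_restrict_space) (auto simp: set_lebesgue_integral_def)
  also have "\<dots> = integral {a..b} f"
    by (rule set_borel_integral_eq_integral) fact
  also have "\<dots> = I" using assms(2) by (rule integral_unique)
  finally show "(\<integral>x. f x \<partial>restrict_space lborel {a..b}) = I" .
qed

text \<open>The integrand is the derivative of \<open>S\<close>, the second difference of an
  antiderivative \<open>R\<close>. By the mean value theorem \<open>S h\<close> is d times a
  difference of values of \<open>p\<close> at points less than 2 d apart, hence at most 2 d^2 in
  absolute value; the two endpoints give 4 d^2.\<close>

lemma second_difference_integral:
  fixes p :: "real \<Rightarrow> real"
  assumes lip: "\<And>x y. \<bar>p x - p y\<bar> \<le> \<bar>x - y\<bar>" and "0 < d" "lo \<le> hi"
  shows "integrable (restrict_space lborel {lo..hi}) (\<lambda>h. p (h + d) - 2 * p h + p (h - d))"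
    and "(\<integral>h. p (h + d) - 2 * p h + p (h - d) \<partial>restrict_space lborel {lo..hi}) \<le> 4 * d ^ 2"
proof -
  \<comment> \<open>The extra margin 1 makes all points that occur interior, so that
    \<open>R\<close> has a two-sided derivative there.\<close>
  define a b where "a = lo - d - 1" and "b = hi + d + 1"
  have cont: "continuous_on S p" for S
  proof -
    have "1-lipschitz_on S p"
      using lip by (auto simp: lipschitz_on_def dist_real_def)
    then show ?thesis by (rule lipschitz_on_continuous_on)
  qed
  obtain R where R: "\<And>x. x \<in> {a..b} \<Longrightarrow> (R has_vector_derivative p x) (at x within {a..b})"
    using antiderivative_continuous[OF cont] by blast
  have R': "(R has_real_derivative p x) (at x)" if "lo - d \<le> x" "x \<le> hi + d" for x
  proof -
    have "x \<in> interior {a..b}" using that by (auto simp: a_def b_def)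
    then show ?thesis
      using R[of x] interior_subset at_within_interior[of x "{a..b}"]
      by (auto simp: has_real_derivative_iff_has_vector_derivative)
  qed
  define S where "S h = R (h + d) - 2 * R h + R (h - d)" for h
  have S': "(S has_real_derivative p (h + d) - 2 * p h + p (h - d)) (at h)" if "lo \<le> h" "h \<le> hi" for h
  proof -
    have 1: "((\<lambda>h. R (h + d)) has_real_derivative p (h + d)) (at h)"
      using R'[of "h + d"] that \<open>0 < d\<close> by (simp add: DERIV_shift)
    have 2: "((\<lambda>h. R (h - d)) has_real_derivative p (h - d)) (at h)"
      using R'[of "h - d"] that \<open>0 < d\<close> DERIV_shift[of R "p (h - d)" h "- d"] by simp
    show ?thesis
      unfolding S_def[abs_def] using R'[of h] that \<open>0 < d\<close>
      by (intro DERIV_add DERIV_diff DERIV_cmult 1 2) auto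
  qed
  have bd: "\<bar>S h\<bar> \<le> 2 * d ^ 2" if "lo \<le> h" "h \<le> hi" for h
  proof -
    obtain x where x: "h < x" "x < h + d" "R (h + d) - R h = (h + d - h) * p x"
    proof (rule exE[OF MVT2[of h "h + d" R p]])
      show "(R has_real_derivative p x) (at x)" if "h \<le> x" "x \<le> h + d" for x
        using R' that \<open>lo \<le> h\<close> \<open>h \<le> hi\<close> \<open>0 < d\<close> by auto
    qed (use \<open>0 < d\<close> in auto)
    obtain y where y: "h - d < y" "y < h" "R h - R (h - d) = (h - (h - d)) * p y"
    proof (rule exE[OF MVT2[of "h - d" h R p]])
      show "(R has_real_derivative p x) (at x)" if "h - d \<le> x" "x \<le> h" for x
        using R' that \<open>lo \<le> h\<close> \<open>h \<le> hi\<close> \<open>0 < d\<close> by auto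
    qed (use \<open>0 < d\<close> in auto)
    have "S h = d * (p x - p y)" using x y by (simp add: S_def algebra_simps)
    moreover have "\<bar>p x - p y\<bar> \<le> 2 * d" using lip[of x y] x y by linarith
    ultimately show ?thesis
      using \<open>0 < d\<close> by (simp add: abs_mult power2_eq_square)
  qed
  have hi: "((\<lambda>h. p (h + d) - 2 * p h + p (h - d)) has_integral (S hi - S lo)) {lo..hi}"
    using S' \<open>lo \<le> hi\<close>
    by (intro fundamental_theorem_of_calculus)
       (auto simp: has_real_derivative_iff_has_vector_derivative intro: has_vector_derivative_at_within)
  have c: "continuous_on {lo..hi} (\<lambda>h. p (h + d) - 2 * p h + p (h - d))"
    by (intro continuous_intros continuous_on_compose2[OF cont[of UNIV]]) auto
  show "integrable (restrict_space lborel {lo..hi}) (\<lambda>h. p (h + d) - 2 * p h + p (h - d))"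
    using integral_restrict_interval(1)[OF \<open>lo \<le> hi\<close> hi c] .
  have "(\<integral>h. p (h + d) - 2 * p h + p (h - d) \<partial>restrict_space lborel {lo..hi}) = S hi - S lo"
    using integral_restrict_interval(2)[OF \<open>lo \<le> hi\<close> hi c] .
  also have "\<dots> \<le> 4 * d ^ 2"
    using bd[of hi] bd[of lo] \<open>lo \<le> hi\<close> by linarith
  finally show "(\<integral>h. p (h + d) - 2 * p h + p (h - d) \<partial>restrict_space lborel {lo..hi}) \<le> 4 * d ^ 2" .
qed

text \<open>The variance of the absolute value is nonnegative, a case of the Cauchy-Schwarz
  inequality.\<close>

lemma (in prob_space) expectation_abs_le_sqrt:
  fixes X :: "'a \<Rightarrow> real"
  assumes [measurable]: "X \<in> borel_measurable M" and sq: "integrable M (\<lambda>x. X x ^ 2)"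
    and "expectation (\<lambda>x. X x ^ 2) \<le> c"
  shows "expectation (\<lambda>x. \<bar>X x\<bar>) \<le> sqrt c"
proof -
  have int: "integrable M X" using square_integrable_imp_integrable[OF _ sq] by simp
  have "0 \<le> variance (\<lambda>x. \<bar>X x\<bar>)" by (simp add: variance_positive)
  also have "\<dots> = expectation (\<lambda>x. X x ^ 2) - (expectation (\<lambda>x. \<bar>X x\<bar>)) ^ 2"
    using variance_eq[of "\<lambda>x. \<bar>X x\<bar>"] int sq by simp
  finally have "(expectation (\<lambda>x. \<bar>X x\<bar>)) ^ 2 \<le> c" using assms(3) by linarith
  then show ?thesis by (rule real_le_rsqrt)
qed

text \<open>The derivative of a random convex function with small variance: it lies between two difference
  quotients, which concentrate, and whose expectations differ by little on average over \<open>h\<close>.\<close>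
lemma (in prob_space) convex_derivative_variance:
  fixes P m :: "real \<Rightarrow> 'a \<Rightarrow> real"
  assumes deriv: "\<And>h \<omega>. ((\<lambda>h. P h \<omega>) has_real_derivative m h \<omega>) (at h)"
    and mono: "\<And>x y \<omega>. x \<le> y \<Longrightarrow> m x \<omega> \<le> m y \<omega>"
    and bound: "\<And>h \<omega>. \<bar>m h \<omega>\<bar> \<le> 1"
    and meas [measurable]: "\<And>h. P h \<in> borel_measurable M" "\<And>h. m h \<in> borel_measurable M"
    and sq: "\<And>h. integrable M (\<lambda>\<omega>. P h \<omega> ^ 2)"
    and var: "\<And>h. 0 < h \<Longrightarrow> h < 1 \<Longrightarrow> variance (P h) \<le> c"
    and d: "0 < d" "0 < lo - d" "hi + d < 1" and le: "lo \<le> hi"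
  shows "(\<integral>h. variance (m h) \<partial>restrict_space lborel {lo..hi}) \<le> 6 * sqrt c / d * (hi - lo) + 8 * d"
proof -
  have intP [simp]: "integrable M (P h)" for h
    using square_integrable_imp_integrable[OF meas(1) sq] .
  have intm [simp]: "integrable M (m h)" for h
    using bound by (intro integrable_bounded) auto
  define p where "p h = expectation (P h)" for h
  define q where "q h = expectation (m h)" for h
  have slope: "m x \<omega> * (y - x) \<le> P y \<omega> - P x \<omega>" "P y \<omega> - P x \<omega> \<le> m y \<omega> * (y - x)"
    if xy: "x < y" for x y \<omega>
  proof -
    obtain z where z: "x < z" "z < y" "P y \<omega> - P x \<omega> = (y - x) * m z \<omega>"
      using MVT2[of x y "\<lambda>h. P h \<omega>" "\<lambda>h. m h \<omega>"] xy deriv by blast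
    then show "m x \<omega> * (y - x) \<le> P y \<omega> - P x \<omega>" "P y \<omega> - P x \<omega> \<le> m y \<omega> * (y - x)"
      using mono[of x z \<omega>] mono[of z y \<omega>] xy by (auto simp: mult.commute)
  qed
  have pslope: "q x * (y - x) \<le> p y - p x" "p y - p x \<le> q y * (y - x)" if xy: "x < y" for x y
  proof -
    have "expectation (\<lambda>\<omega>. m x \<omega> * (y - x)) \<le> expectation (\<lambda>\<omega>. P y \<omega> - P x \<omega>)"
      "expectation (\<lambda>\<omega>. P y \<omega> - P x \<omega>) \<le> expectation (\<lambda>\<omega>. m y \<omega> * (y - x))"
      by (rule integral_mono; simp add: slope[OF xy])+
    then show "q x * (y - x) \<le> p y - p x" "p y - p x \<le> q y * (y - x)"
      by (simp_all add: p_def q_def)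
  qed
  have qb: "\<bar>q h\<bar> \<le> 1" for h unfolding q_def using bound by (intro abs_expectation_le) auto
  have lip: "\<bar>p x - p y\<bar> \<le> \<bar>x - y\<bar>" for x y
  proof -
    have *: "\<bar>p y - p x\<bar> \<le> y - x" if "x < y" for x y
    proof -
      have "q y * (y - x) \<le> 1 * (y - x)" "(- 1) * (y - x) \<le> q x * (y - x)"
        by (rule mult_right_mono; use qb[of x] qb[of y] that in linarith)+
      then have "p y - p x \<le> 1 * (y - x)" "(- 1) * (y - x) \<le> p y - p x"
        using pslope[OF that] by (blast intro: order_trans)+
      then show ?thesis by simp
    qed
    show ?thesis using *[of x y] *[of y x] by (cases x y rule: linorder_cases) (auto simp: abs_minus_commute)
  qed
  \<comment> \<open>The gap between the forward and the backward difference quotient of the mean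
    pressure, nonnegative by convexity.\<close>
  define D where "D h = (p (h + d) - 2 * p h + p (h - d)) / d" for h
  have D0: "0 \<le> D h" for h
    using pslope(1)[of h "h + d"] pslope(2)[of "h - d" h] d by (simp add: D_def)
  have absP: "expectation (\<lambda>\<omega>. \<bar>P h \<omega> - p h\<bar>) \<le> sqrt c" if "0 < h" "h < 1" for h
  proof (rule expectation_abs_le_sqrt)
    have "integrable M (\<lambda>\<omega>. P h \<omega> ^ 2 - 2 * p h * P h \<omega> + p h ^ 2)"
      by (simp add: sq)
    then show "integrable M (\<lambda>\<omega>. (P h \<omega> - p h) ^ 2)"
      by (simp add: power2_diff algebra_simps)
  qed (use var[OF that] in \<open>auto simp: p_def\<close>)
  have pt: "variance (m h) \<le> 6 * sqrt c / d + 2 * D h" if h: "h \<in> {lo..hi}" for h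
  proof -
    define A where "A h \<omega> = \<bar>P h \<omega> - p h\<bar>" for h \<omega>
    have [simp]: "integrable M (A h)" for h unfolding A_def by simp
    have dev: "\<bar>m h \<omega> - q h\<bar> \<le> (A (h + d) \<omega> + A h \<omega> + A (h - d) \<omega>) / d + D h" for \<omega>
    proof -
      \<comment> \<open>\<open>m h \<omega>\<close> and \<open>q h\<close> each lie between the
        backward and the forward quotients of \<open>P\<close> and of \<open>p\<close>. Comparing
        opposite quotients and then replacing \<open>P\<close> by \<open>p\<close> costs three
        deviations \<open>A\<close> and the gap \<open>D h\<close>.\<close>
      have "d * (m h \<omega> - q h) \<le> (P (h + d) \<omega> - P h \<omega>) - (p h - p (h - d))"
        "d * (q h - m h \<omega>) \<le> (p (h + d) - p h) - (P h \<omega> - P (h - d) \<omega>)"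
        using slope[of h "h + d" \<omega>] slope[of "h - d" h \<omega>] pslope[of h "h + d"] pslope[of "h - d" h] d
        by (auto simp: algebra_simps)
      then have "d * (m h \<omega> - q h) \<le> A (h + d) \<omega> + A h \<omega> + A (h - d) \<omega> + d * D h"
        "d * (q h - m h \<omega>) \<le> A (h + d) \<omega> + A h \<omega> + A (h - d) \<omega> + d * D h"
        using d by (auto simp: A_def D_def)
      then have "d * \<bar>m h \<omega> - q h\<bar> \<le> A (h + d) \<omega> + A h \<omega> + A (h - d) \<omega> + d * D h"
        by (auto simp: abs_if algebra_simps)
      then show ?thesis using d by (simp add: field_simps)
    qed
    have "variance (m h) \<le> expectation (\<lambda>\<omega>. 2 * ((A (h + d) \<omega> + A h \<omega> + A (h - d) \<omega>) / d + D h))"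
    proof (rule integral_mono')
      fix \<omega>
      have "(m h \<omega> - q h) ^ 2 = \<bar>m h \<omega> - q h\<bar> * \<bar>m h \<omega> - q h\<bar>" by (simp add: power2_eq_square)
      \<comment> \<open>Both values lie in [-1, 1], so the square is at most twice the absolute
        deviation and first moments suffice; three deviations give the constant 6.\<close>
      also have "\<dots> \<le> 2 * \<bar>m h \<omega> - q h\<bar>"
        using bound[of h \<omega>] qb[of h] by (intro mult_right_mono) linarith+
      also have "\<dots> \<le> 2 * ((A (h + d) \<omega> + A h \<omega> + A (h - d) \<omega>) / d + D h)"
        by (rule mult_left_mono[OF dev]) simp
      finally show "(m h \<omega> - expectation (m h)) ^ 2 \<le> 2 * ((A (h + d) \<omega> + A h \<omega> + A (h - d) \<omega>) / d + D h)"
        unfolding q_def .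
      show "0 \<le> 2 * ((A (h + d) \<omega> + A h \<omega> + A (h - d) \<omega>) / d + D h)"
        using D0[of h] d by (simp add: A_def)
    qed simp
    also have "\<dots> = 2 * ((expectation (A (h + d)) + expectation (A h) + expectation (A (h - d))) / d + D h)"
      by (simp add: prob_space)
    also have "\<dots> \<le> 2 * ((sqrt c + sqrt c + sqrt c) / d + D h)"
      using h d unfolding A_def
      by (intro mult_left_mono add_right_mono divide_right_mono add_mono absP) auto
    finally show ?thesis by (simp add: field_simps)
  qed
  \<comment> \<open>\<open>sqrt\<close> of a negative real is negative in HOL, so the sign has to be
    read off from a first-moment bound.\<close>
  have c0: "0 \<le> sqrt c"
  proof -
    have "0 \<le> expectation (\<lambda>\<omega>. \<bar>P lo \<omega> - p lo\<bar>)" by (rule integral_nonneg_AE) simp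
    then show ?thesis using absP[of lo] d le by linarith
  qed
  have intD: "integrable (restrict_space lborel {lo..hi}) D"
    unfolding D_def using second_difference_integral(1)[OF lip d(1) le] by simp
  interpret L: finite_measure "restrict_space lborel {lo..hi}"
    by (rule finite_measure_restrict_interval)
  have "(\<integral>h. variance (m h) \<partial>restrict_space lborel {lo..hi})
      \<le> (\<integral>h. 6 * sqrt c / d + 2 * D h \<partial>restrict_space lborel {lo..hi})"
    by (rule integral_mono') (use pt intD D0 c0 d in \<open>auto simp: space_restrict_space\<close>)
  also have "\<dots> = 6 * sqrt c / d * (hi - lo) + 2 * (\<integral>h. D h \<partial>restrict_space lborel {lo..hi})"
    using intD le by (simp add: space_restrict_space measure_restrict_space)
  also have "(\<integral>h. D h \<partial>restrict_space lborel {lo..hi}) \<le> 4 * d ^ 2 / d"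
    unfolding D_def using second_difference_integral(2)[OF lip d(1) le] d
    by (simp add: divide_right_mono)
  finally show ?thesis using d by (simp add: power2_eq_square)
qed

text \<open>Exchange the two integrals: for each \<omega> the inner integral telescopes to the
  increment of \<open>m\<close> divided by a, and an increment of a function bounded by 1 is at most
  2.\<close>

lemma (in prob_space) integral_derivative_le:
  fixes m T :: "real \<Rightarrow> 'a \<Rightarrow> real"
  assumes deriv: "\<And>h \<omega>. ((\<lambda>h. m h \<omega>) has_real_derivative a * T h \<omega>) (at h)"
    and cont: "\<And>\<omega>. continuous_on UNIV (\<lambda>h. T h \<omega>)"
    and bound: "\<And>h \<omega>. \<bar>m h \<omega>\<bar> \<le> 1" "\<And>h \<omega>. \<bar>T h \<omega>\<bar> \<le> 1"
    and meas [measurable]: "case_prod T \<in> borel_measurable (borel \<Otimes>\<^sub>M M)"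
    and "lo \<le> hi" "0 < a"
  shows "(\<integral>h. expectation (T h) \<partial>restrict_space lborel {lo..hi}) \<le> 2 / a"
proof -
  let ?L = "restrict_space lborel {lo..hi}"
  interpret L: finite_measure ?L
    by (rule finite_measure_restrict_interval)
  interpret P: pair_sigma_finite ?L M ..
  have m': "case_prod T \<in> borel_measurable (?L \<Otimes>\<^sub>M M)"
  proof -
    have "(\<lambda>x. (fst x, snd x)) \<in> measurable (?L \<Otimes>\<^sub>M M) (borel \<Otimes>\<^sub>M M)"
      by (intro measurable_Pair measurable_compose[OF measurable_fst measurable_restrict_space1]) auto
    from measurable_compose[OF this meas] show ?thesis by simp
  qed
  have fin: "finite_measure (?L \<Otimes>\<^sub>M M)"
    using L.finite_measure_axioms finite_measure_axioms by (intro finite_measure_pair_measure)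
  have int: "integrable (?L \<Otimes>\<^sub>M M) (case_prod T)"
    using bound m' by (intro finite_measure.integrable_const_bound[OF fin, of _ 1]) auto
  have "(\<integral>h. expectation (T h) \<partial>?L) = expectation (\<lambda>\<omega>. \<integral>h. T h \<omega> \<partial>?L)"
    using P.Fubini_integral[OF int] by simp
  also have "\<dots> = expectation (\<lambda>\<omega>. (m hi \<omega> - m lo \<omega>) / a)"
  proof (rule Bochner_Integration.integral_cong[OF refl])
    fix \<omega>
    have "((\<lambda>h. T h \<omega>) has_integral (m hi \<omega> / a - m lo \<omega> / a)) {lo..hi}"
      using \<open>lo \<le> hi\<close> DERIV_cdivide[OF deriv, of \<omega> a] \<open>0 < a\<close>
      by (intro fundamental_theorem_of_calculus)
         (auto simp: has_real_derivative_iff_has_vector_derivative[symmetric] intro: DERIV_subset)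
    from integral_restrict_interval(2)[OF \<open>lo \<le> hi\<close> this continuous_on_subset[OF cont]]
    show "(\<integral>h. T h \<omega> \<partial>?L) = (m hi \<omega> - m lo \<omega>) / a" by (simp add: diff_divide_distrib)
  qed
  also have "\<dots> \<le> \<bar>expectation (\<lambda>\<omega>. (m hi \<omega> - m lo \<omega>) / a)\<bar>" by (rule abs_ge_self)
  also have "\<dots> \<le> 2 / a"
  proof (rule abs_expectation_le)
    fix \<omega>
    have "\<bar>m hi \<omega> - m lo \<omega>\<bar> \<le> 2" using bound(1)[of hi \<omega>] bound(1)[of lo \<omega>] by linarith
    then show "\<bar>(m hi \<omega> - m lo \<omega>) / a\<bar> \<le> 2 / a"
      using \<open>0 < a\<close> by (simp add: divide_right_mono)
  qed
  finally show ?thesis .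
qed

section \<open>Measurability and moments of the disorder\<close>

text \<open>Both integrand and measure depend on x. Pushing \<open>L x\<close> forward along y to
  (x, y) leaves a fixed integrand on the product space and a measurable family of measures.\<close>

lemma integral_kernel_measurable:
  fixes f :: "'a \<Rightarrow> 'b \<Rightarrow> real"
  assumes f [measurable]: "case_prod f \<in> borel_measurable (M \<Otimes>\<^sub>M N)"
    and L [measurable]: "L \<in> measurable M (subprob_algebra N)"
  shows "(\<lambda>x. integral\<^sup>L (L x) (f x)) \<in> borel_measurable M"
proof -
  note measurable_distr2 [measurable]
  have "(\<lambda>x. integral\<^sup>L (distr (L x) (M \<Otimes>\<^sub>M N) (\<lambda>y. (x, y))) (case_prod f)) \<in> borel_measurable M"
    by measurable
  then show ?thesis
    by (rule measurable_cong[THEN iffD1, rotated])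
       (simp add: integral_distr sets_kernel[OF L] cong: measurable_cong_sets)
qed

text \<open>As k^2 \<le> 2 e^k, the second moment is dominated by the exponential series at r
  e.\<close>

lemma poisson_square_integrable:
  assumes "0 < r" shows "integrable (measure_pmf (poisson_pmf r)) (\<lambda>k. real k ^ 2)"
proof -
  have le: "real k ^ 2 \<le> 2 * exp (real k)" for k
    using exp_lower_Taylor_quadratic[of "real k"] by simp
  have "summable (\<lambda>k. 2 * (inverse (fact k) * (r * exp 1) ^ k))"
    by (intro summable_mult summable_exp)
  then have "summable (\<lambda>k. r ^ k / fact k * exp (- r) * real k ^ 2)"
  proof (rule summable_comparison_test'[where N=0])
    fix k :: nat
    have "norm (r ^ k / fact k * exp (- r) * real k ^ 2) = r ^ k / fact k * exp (- r) * real k ^ 2"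
      using assms by simp
    also have "\<dots> \<le> r ^ k / fact k * 1 * (2 * exp (real k))"
      using assms le by (intro mult_mono) auto
    also have "\<dots> = 2 * (inverse (fact k) * (r * exp 1) ^ k)"
      by (simp add: power_mult_distrib exp_of_nat_mult[symmetric] field_simps)
    finally show "norm (r ^ k / fact k * exp (- r) * real k ^ 2) \<le> 2 * (inverse (fact k) * (r * exp 1) ^ k)" .
  qed
  then show ?thesis
    using assms unfolding measure_pmf_eq_density
    by (subst integrable_density) (auto simp: integrable_count_space_nat_iff)
qed

text \<open>It suffices to check the intersection-stable generator of boxes, whose mass is a finite
  product of countable sums of explicit Poisson weights. Positivity of the rate gives the formula
  for the weights.\<close>

lemma poisson_PiM_kernel:
  fixes r :: "real \<Rightarrow> real"
  assumes "finite I" and [measurable]: "r \<in> borel_measurable borel" and pos: "\<And>x. 0 < r x"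
  shows "(\<lambda>x. PiM I (\<lambda>_. measure_pmf (poisson_pmf (r x))))
    \<in> measurable borel (prob_algebra (PiM I (\<lambda>_. count_space UNIV)))"
proof (rule measurable_prob_algebra_generated[where \<Omega>="PiE I (\<lambda>_. UNIV)" and
      G="prod_algebra I (\<lambda>_. count_space (UNIV :: nat set))"])
  show "sets (PiM I (\<lambda>_. count_space (UNIV :: nat set))) =
      sigma_sets (PiE I (\<lambda>_. UNIV)) (prod_algebra I (\<lambda>_. count_space UNIV))"
    by (simp add: sets_PiM)
  show "Int_stable (prod_algebra I (\<lambda>_. count_space (UNIV :: nat set)))"
    by (rule Int_stable_prod_algebra)
  show "prod_algebra I (\<lambda>_. count_space (UNIV :: nat set)) \<subseteq> Pow (PiE I (\<lambda>_. UNIV))"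
    using prod_algebra_sets_into_space[of I "\<lambda>_. count_space (UNIV :: nat set)"] by simp
  show "prob_space (PiM I (\<lambda>_. measure_pmf (poisson_pmf (r x))))" for x
    by (intro prob_space_PiM measure_pmf.prob_space_axioms)
  show "sets (PiM I (\<lambda>_. measure_pmf (poisson_pmf (r x)))) = sets (PiM I (\<lambda>_. count_space UNIV))" for x
    by (intro sets_PiM_cong) auto
  fix A assume "A \<in> prod_algebra I (\<lambda>_. count_space (UNIV :: nat set))"
  then obtain X where A: "A = PiE I X"
    using prod_algebra_eq_finite[OF \<open>finite I\<close>, of "\<lambda>_. count_space (UNIV :: nat set)"] by auto
  have "emeasure (PiM I (\<lambda>_. measure_pmf (poisson_pmf (r x)))) A =
      (\<Prod>i\<in>I. \<Sum>k. ennreal (r x ^ k / fact k * exp (- r x)) * indicator (X i) k)" for x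
  proof -
    interpret product_sigma_finite "\<lambda>_. measure_pmf (poisson_pmf (r x))"
      by standard
    have "emeasure (PiM I (\<lambda>_. measure_pmf (poisson_pmf (r x)))) A =
       (\<Prod>i\<in>I. emeasure (measure_pmf (poisson_pmf (r x))) (X i))"
      unfolding A using \<open>finite I\<close> by (intro emeasure_PiM) auto
    then show ?thesis using pos[of x] 
      by (simp add: nn_integral_pmf[symmetric] nn_integral_count_space_indicator nn_integral_count_space_nat)
  qed
  then show "(\<lambda>x. emeasure (PiM I (\<lambda>_. measure_pmf (poisson_pmf (r x)))) A) \<in> borel_measurable borel"
    by simp
qed

text \<open>A reference space depending neither on the coupling laws nor on the Poisson rate; only
  its measurable structure matters. Joint measurability in field and disorder is thus proved once
  for all parameters.\<close>

definition disorder_space :: "nat \<Rightarrow> ((nat set \<Rightarrow> real) \<times> (nat \<Rightarrow> nat)) measure" where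
  "disorder_space n = PiM (Pow {..<n}) (\<lambda>_. borel) \<Otimes>\<^sub>M PiM {..<n} (\<lambda>_. count_space UNIV)"

lemma measurable_hamiltonian:
  "(\<lambda>(h0, \<omega>). hamiltonian n (fst \<omega>) (snd \<omega>) h0 h1 \<sigma>) \<in> borel_measurable (borel \<Otimes>\<^sub>M disorder_space n)"
proof -
  have [measurable]: "(\<lambda>x. fst (snd x) X) \<in> borel_measurable (borel \<Otimes>\<^sub>M disorder_space n)"
    if "X \<in> Pow {..<n}" for X
    using that unfolding disorder_space_def by measurable
  have [measurable]: "(\<lambda>x. snd (snd x) i) \<in> measurable (borel \<Otimes>\<^sub>M disorder_space n) (count_space UNIV)"
    if "i \<in> {..<n}" for i
    using that unfolding disorder_space_def by measurable
  show ?thesis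
    unfolding hamiltonian_def case_prod_beta
    by (intro borel_measurable_diff borel_measurable_uminus borel_measurable_sum borel_measurable_times) measurable
qed

lemma measurable_partition_fun [measurable]:
  "(\<lambda>(h0, \<omega>). partition_fun n (fst \<omega>) (snd \<omega>) h0 h1) \<in> borel_measurable (borel \<Otimes>\<^sub>M disorder_space n)"
  using measurable_hamiltonian unfolding partition_fun_def case_prod_beta by measurable

lemma measurable_gibbs1 [measurable]:
  "(\<lambda>(h0, \<omega>). gibbs1 n (fst \<omega>) (snd \<omega>) h0 h1 f) \<in> borel_measurable (borel \<Otimes>\<^sub>M disorder_space n)"
  using measurable_hamiltonian measurable_partition_fun unfolding gibbs1_def case_prod_beta by measurable

lemma measurable_gibbs [measurable]:
  "(\<lambda>(h0, \<omega>). gibbs n (fst \<omega>) (snd \<omega>) h0 h1 k f) \<in> borel_measurable (borel \<Otimes>\<^sub>M disorder_space n)"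
  using measurable_hamiltonian measurable_partition_fun unfolding gibbs_def case_prod_beta by measurable

lemma measurable_magnetization [measurable]:
  "(\<lambda>(h0, \<omega>). magnetization n (fst \<omega>) (snd \<omega>) h1 h0) \<in> borel_measurable (borel \<Otimes>\<^sub>M disorder_space n)"
  unfolding magnetization_def by measurable

lemma measurable_thermal_var [measurable]:
  "(\<lambda>(h0, \<omega>). thermal_var n (fst \<omega>) (snd \<omega>) h1 h0) \<in> borel_measurable (borel \<Otimes>\<^sub>M disorder_space n)"
  using measurable_gibbs1 measurable_magnetization unfolding thermal_var_def case_prod_beta by measurable

lemma measurable_pressure [measurable]:
  "(\<lambda>(h0, \<omega>). pressure n (fst \<omega>) (snd \<omega>) h0 h1) \<in> borel_measurable (borel \<Otimes>\<^sub>M disorder_space n)"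
  using measurable_partition_fun unfolding pressure_def case_prod_beta by measurable

text \<open>With \<open>S\<close> dominating the energy of every configuration, the partition
  function lies between \<open>exp (- S)\<close> and the number of configurations times
  \<open>exp S\<close>. The bound is linear in the moduli of the couplings and in the fields, which
  makes second moments accessible.\<close>

lemma abs_pressure_le:
  "\<bar>pressure n J \<tau> h0 h1\<bar> \<le> (ln (real (card (spin_configs n))) + real n * \<bar>h0\<bar>
     + (\<Sum>X\<in>Pow {..<n}. \<bar>J X\<bar>) + \<bar>h1\<bar> * (\<Sum>i<n. real (\<tau> i))) / real n"
proof -
  define S where "S = (\<Sum>X\<in>Pow {..<n}. \<bar>J X\<bar>) + real n * \<bar>h0\<bar> + \<bar>h1\<bar> * (\<Sum>i<n. real (\<tau> i))"
  have H: "\<bar>hamiltonian n J \<tau> h0 h1 \<sigma>\<bar> \<le> S" if \<sigma>: "\<sigma> \<in> spin_configs n" for \<sigma>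
  proof -
    have "\<bar>\<Sum>X\<in>Pow {..<n}. J X * (\<Prod>i\<in>X. \<sigma> i)\<bar> \<le> (\<Sum>X\<in>Pow {..<n}. \<bar>J X\<bar>)"
      by (rule order_trans[OF sum_abs]) (simp add: abs_mult abs_prod_spin[OF \<sigma>])
    moreover have "\<bar>h0 * (\<Sum>i<n. \<sigma> i)\<bar> \<le> real n * \<bar>h0\<bar>"
    proof -
      have "\<bar>\<Sum>i<n. \<sigma> i\<bar> \<le> real n"
        using sum_abs[of \<sigma> "{..<n}"] by (simp add: abs_spin[OF \<sigma>])
      then have "\<bar>h0\<bar> * \<bar>\<Sum>i<n. \<sigma> i\<bar> \<le> \<bar>h0\<bar> * real n" by (rule mult_left_mono) simp
      then show ?thesis by (simp add: abs_mult mult.commute)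
    qed
    moreover have "\<bar>h1 * (\<Sum>i<n. real (\<tau> i) * \<sigma> i)\<bar> \<le> \<bar>h1\<bar> * (\<Sum>i<n. real (\<tau> i))"
      unfolding abs_mult
      by (intro mult_left_mono order_trans[OF sum_abs]) (auto simp: abs_mult abs_spin[OF \<sigma>])
    ultimately show ?thesis unfolding hamiltonian_def S_def by linarith
  qed
  have ne: "spin_configs n \<noteq> {}" using one_in_spin_configs[of n] by blast
  then have card: "0 < real (card (spin_configs n))" by (simp add: card_gt_0_iff)
  have "partition_fun n J \<tau> h0 h1 \<le> (\<Sum>\<sigma>\<in>spin_configs n. exp S)"
    unfolding partition_fun_def using H by (intro sum_mono) (force simp: abs_le_iff)
  then have "ln (partition_fun n J \<tau> h0 h1) \<le> ln (real (card (spin_configs n)) * exp S)"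
    using partition_fun_pos[of n J \<tau> h0 h1] by (intro ln_mono) auto
  then have 1: "ln (partition_fun n J \<tau> h0 h1) \<le> ln (real (card (spin_configs n))) + S"
    using card ne by (simp add: ln_mult)
  \<comment> \<open>A single configuration, all spins up, gives the lower bound.\<close>
  have "exp (- S) \<le> exp (- hamiltonian n J \<tau> h0 h1 (\<lambda>_. 1))"
    using H[of "\<lambda>_. 1"] by (simp add: abs_le_iff)
  also have "\<dots> \<le> partition_fun n J \<tau> h0 h1"
    unfolding partition_fun_def by (rule member_le_sum) auto
  finally have "- S \<le> ln (partition_fun n J \<tau> h0 h1)"
    using partition_fun_pos[of n J \<tau> h0 h1] by (simp add: ln_ge_iff)
  moreover have "0 \<le> ln (real (card (spin_configs n)))" using card by (simp add: Suc_le_eq)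
  ultimately have "\<bar>ln (partition_fun n J \<tau> h0 h1)\<bar> \<le> ln (real (card (spin_configs n))) + S"
    using 1 by linarith
  then show ?thesis
    unfolding pressure_def S_def abs_divide by (simp add: divide_right_mono algebra_simps)
qed

section \<open>Square integrability of sums and a marginal of a product law\<close>

lemma square_integrable_add:
  fixes f g :: "'a \<Rightarrow> real"
  assumes [measurable]: "f \<in> borel_measurable M" "g \<in> borel_measurable M"
    and "integrable M (\<lambda>x. f x ^ 2)" "integrable M (\<lambda>x. g x ^ 2)"
  shows "integrable M (\<lambda>x. (f x + g x) ^ 2)"
proof (rule Bochner_Integration.integrable_bound)
  show "integrable M (\<lambda>x. 2 * f x ^ 2 + 2 * g x ^ 2)" using assms by simp
  show "AE x in M. norm ((f x + g x) ^ 2) \<le> norm (2 * f x ^ 2 + 2 * g x ^ 2)"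
  proof (rule AE_I2)
    fix x
    have "(f x + g x) ^ 2 \<le> 2 * f x ^ 2 + 2 * g x ^ 2"
      using zero_le_power2[of "f x - g x"] by (simp add: power2_sum power2_diff)
    then show "norm ((f x + g x) ^ 2) \<le> norm (2 * f x ^ 2 + 2 * g x ^ 2)" by simp
  qed
qed measurable

lemma square_integrable_sum:
  fixes f :: "'i \<Rightarrow> 'a \<Rightarrow> real"
  assumes "finite I" "\<And>i. i \<in> I \<Longrightarrow> f i \<in> borel_measurable M"
    and "\<And>i. i \<in> I \<Longrightarrow> integrable M (\<lambda>x. f i x ^ 2)"
  shows "integrable M (\<lambda>x. (\<Sum>i\<in>I. f i x) ^ 2)"
  using assms
proof (induction I rule: finite_induct)
  case (insert i I)
  have "integrable M (\<lambda>x. (f i x + (\<Sum>i\<in>I. f i x)) ^ 2)"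
    using insert by (intro square_integrable_add borel_measurable_sum) auto
  then show ?case using insert.hyps by simp
qed simp

lemma distr_pair_snd:
  assumes "prob_space M" "prob_space N"
  shows "distr (M \<Otimes>\<^sub>M N) N snd = N"
proof -
  interpret M: prob_space M by fact
  interpret N: prob_space N by fact
  interpret pair_sigma_finite M N ..
  have "distr (M \<Otimes>\<^sub>M N) N snd = distr (distr (N \<Otimes>\<^sub>M M) (M \<Otimes>\<^sub>M N) (\<lambda>(x, y). (y, x))) N snd"
    by (subst distr_pair_swap) simp
  also have "\<dots> = distr (N \<Otimes>\<^sub>M M) N fst"
    by (subst distr_distr) (auto simp: comp_def case_prod_beta)
  also have "\<dots> = N" by (rule M.distr_pair_fst)
  finally show ?thesis .
qed

section \<open>Multi-overlaps under the disorder\<close>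

lemma abs_overlap_le:
  assumes "0 < n" "s \<in> replica_configs n k" shows "\<bar>overlap n k s\<bar> \<le> 1"
proof -
  have "\<bar>\<Sum>i<n. \<Prod>r<k. s r i\<bar> \<le> (\<Sum>i<n. 1)"
    using replica_configsD[OF assms(2)]
    by (intro order_trans[OF sum_abs] sum_mono) (simp add: abs_prod abs_spin[where n=n])
  then show ?thesis using assms(1) by (simp add: overlap_def abs_mult field_simps)
qed

lemma abs_gibbs_overlap_le:
  assumes "0 < n" shows "\<bar>gibbs n J \<tau> h0 h1 k (overlap n k)\<bar> \<le> 1"
  using gibbs_mono[of n k "overlap n k" "\<lambda>_. 1" J \<tau> h0 h1]
    gibbs_mono[of n k "\<lambda>_. - 1" "overlap n k" J \<tau> h0 h1] abs_overlap_le[OF assms]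
  by (fastforce simp: abs_le_iff)

lemma abs_gibbs_overlap_square_le:
  assumes "0 < n" shows "\<bar>gibbs n J \<tau> h0 h1 k (\<lambda>s. overlap n k s ^ 2)\<bar> \<le> 1"
proof -
  have "overlap n k s ^ 2 \<le> 1" if "s \<in> replica_configs n k" for s
    using abs_overlap_le[OF assms that] by (simp add: abs_square_le_1)
  then show ?thesis
    using gibbs_mono[of n k "\<lambda>s. overlap n k s ^ 2" "\<lambda>_. 1" J \<tau> h0 h1]
      gibbs_mono[of n k "\<lambda>_. 0" "\<lambda>s. overlap n k s ^ 2" J \<tau> h0 h1]
    by (simp add: abs_le_iff)
qed

text \<open>AM-GM is used in the form \<open>2 \<bar>x\<bar> \<le> x\<^sup>2 / \<epsilon> + \<epsilon>\<close>, so that no square root has to be integrated.\<close>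
lemma gibbs_abs_power_diff_le:
  assumes "0 < n" "\<bar>c\<bar> \<le> 1" "0 < \<epsilon>"
  shows "gibbs n J \<tau> h0 h1 k (\<lambda>s. \<bar>overlap n k s ^ p - c ^ p\<bar>) \<le>
    real p * ((gibbs n J \<tau> h0 h1 k (\<lambda>s. overlap n k s ^ 2)
      - 2 * c * gibbs n J \<tau> h0 h1 k (overlap n k) + c ^ 2) / (2 * \<epsilon>) + \<epsilon> / 2)"
proof -
  have "gibbs n J \<tau> h0 h1 k (\<lambda>s. \<bar>overlap n k s ^ p - c ^ p\<bar>) \<le>
    gibbs n J \<tau> h0 h1 k (\<lambda>s. real p / (2 * \<epsilon>) * overlap n k s ^ 2
      + ((- (real p * c / \<epsilon>)) * overlap n k s + real p * (c ^ 2 / (2 * \<epsilon>) + \<epsilon> / 2)))"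
  proof (rule gibbs_mono)
    fix s assume s: "s \<in> replica_configs n k"
    define q where "q = overlap n k s"
    have q: "\<bar>q\<bar> \<le> 1" unfolding q_def by (rule abs_overlap_le[OF assms(1) s])
    have "0 \<le> (\<bar>q - c\<bar> - \<epsilon>) ^ 2" by simp
    then have "2 * \<epsilon> * \<bar>q - c\<bar> \<le> (q - c) ^ 2 + \<epsilon> ^ 2"
      by (simp add: power2_diff[of "\<bar>q - c\<bar>"] mult.commute mult.left_commute)
    then have "\<bar>q - c\<bar> \<le> ((q - c) ^ 2 + \<epsilon> ^ 2) / (2 * \<epsilon>)"
      using assms(3) by (simp add: field_simps)
    then have le: "\<bar>q - c\<bar> \<le> (q - c) ^ 2 / (2 * \<epsilon>) + \<epsilon> / 2"
      using assms(3) by (simp add: add_divide_distrib power2_eq_square)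
    have "\<bar>q ^ p - c ^ p\<bar> \<le> real p * \<bar>q - c\<bar>"
      using norm_power_diff[of q c p] q assms(2) by simp
    also have "\<dots> \<le> real p * ((q - c) ^ 2 / (2 * \<epsilon>) + \<epsilon> / 2)"
      by (intro mult_left_mono le) simp
    also have "\<dots> = real p / (2 * \<epsilon>) * q ^ 2
      + ((- (real p * c / \<epsilon>)) * q + real p * (c ^ 2 / (2 * \<epsilon>) + \<epsilon> / 2))"
      using assms(3) by (simp add: power2_diff field_simps)
    finally show "\<bar>overlap n k s ^ p - c ^ p\<bar> \<le> real p / (2 * \<epsilon>) * overlap n k s ^ 2
      + ((- (real p * c / \<epsilon>)) * overlap n k s + real p * (c ^ 2 / (2 * \<epsilon>) + \<epsilon> / 2))"
      unfolding q_def .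
  qed
  also have "\<dots> = real p / (2 * \<epsilon>) * gibbs n J \<tau> h0 h1 k (\<lambda>s. overlap n k s ^ 2)
      + ((- (real p * c / \<epsilon>)) * gibbs n J \<tau> h0 h1 k (overlap n k) + real p * (c ^ 2 / (2 * \<epsilon>) + \<epsilon> / 2))"
    by (simp only: gibbs_add gibbs_cmult gibbs_const)
  also have "\<dots> = real p * ((gibbs n J \<tau> h0 h1 k (\<lambda>s. overlap n k s ^ 2)
      - 2 * c * gibbs n J \<tau> h0 h1 k (overlap n k) + c ^ 2) / (2 * \<epsilon>) + \<epsilon> / 2)"
    using assms(3) by (simp add: field_simps)
  finally show ?thesis .
qed

text \<open>The slack \<open>k m - m\<^sup>k\<close> is nondecreasing on the unit interval, hence a nondecreasing function
  of the disorder.\<close>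
lemma gibbs_overlap_mono:
  assumes "\<forall>X\<in>Pow {..<n}. 0 \<le> J X" "0 \<le> h0" "0 \<le> h1"
    and "\<forall>X\<in>Pow {..<n}. J X \<le> J' X" "\<forall>i\<in>{..<n}. \<tau> i \<le> \<tau>' i"
  shows "gibbs n J \<tau> h0 h1 k (overlap n k) \<le> gibbs n J' \<tau>' h0 h1 k (overlap n k)"
    and "real k * magnetization n J \<tau> h1 h0 - gibbs n J \<tau> h0 h1 k (overlap n k)
      \<le> real k * magnetization n J' \<tau>' h1 h0 - gibbs n J' \<tau>' h0 h1 k (overlap n k)"
proof -
  let ?m = "\<lambda>i. gibbs1 n J \<tau> h0 h1 (\<lambda>\<sigma>. \<sigma> i)" and ?m' = "\<lambda>i. gibbs1 n J' \<tau>' h0 h1 (\<lambda>\<sigma>. \<sigma> i)"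
  have m: "0 \<le> ?m i" "?m i \<le> ?m' i" "?m' i \<le> 1" if "i < n" for i
    using gibbs1_site_nonneg[OF assms(1-3) that] gibbs1_site_mono[OF assms that]
      abs_gibbs1_site_le[of n J' \<tau>' h0 h1 i] by auto
  show "gibbs n J \<tau> h0 h1 k (overlap n k) \<le> gibbs n J' \<tau>' h0 h1 k (overlap n k)"
    unfolding gibbs_overlap using m by (intro divide_right_mono sum_mono power_mono) auto
  have eq: "real k * magnetization n J \<tau> h1 h0 - gibbs n J \<tau> h0 h1 k (overlap n k) =
      (\<Sum>i<n. real k * gibbs1 n J \<tau> h0 h1 (\<lambda>\<sigma>. \<sigma> i) - gibbs1 n J \<tau> h0 h1 (\<lambda>\<sigma>. \<sigma> i) ^ k) / real n" for J \<tau>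
    by (simp add: gibbs_overlap magnetization_sites sum_subtractf sum_distrib_left diff_divide_distrib)
  show "real k * magnetization n J \<tau> h1 h0 - gibbs n J \<tau> h0 h1 k (overlap n k)
      \<le> real k * magnetization n J' \<tau>' h1 h0 - gibbs n J' \<tau>' h0 h1 k (overlap n k)"
    unfolding eq
  proof (intro divide_right_mono sum_mono)
    fix i assume "i \<in> {..<n}"
    then show "real k * ?m i - ?m i ^ k \<le> real k * ?m' i - ?m' i ^ k"
      using power_diff_le[of "?m i" "?m' i" k] m[of i] by (simp add: right_diff_distrib)
  qed simp
qed

section \<open>The disorder law at one fixed system size\<close>

locale disorder_model =
  fixes D :: "nat \<Rightarrow> nat set \<Rightarrow> real measure" and \<theta> :: real and n :: nat
  assumes n_pos: "0 < n"
    and D_prob: "\<And>X. X \<in> Pow {..<n} \<Longrightarrow> prob_space (D n X)"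
    and D_borel: "\<And>X. X \<in> Pow {..<n} \<Longrightarrow> sets (D n X) = sets borel"
    and D_nonneg: "\<And>X. X \<in> Pow {..<n} \<Longrightarrow> AE x in D n X. 0 \<le> x"
    and D_L2: "\<And>X. X \<in> Pow {..<n} \<Longrightarrow> integrable (D n X) (\<lambda>x. x ^ 2)"
begin

abbreviation law where "law \<alpha> \<equiv> disorder D \<theta> n \<alpha>"

abbreviation coupling_law where "coupling_law \<equiv> PiM (Pow {..<n}) (D n)"

abbreviation field_law where
  "field_law \<alpha> \<equiv> PiM {..<n} (\<lambda>_. measure_pmf (poisson_pmf (\<alpha> * real n powr (\<theta> - 1))))"

lemma prob_coupling_law: "prob_space coupling_law"
  by (intro prob_space_PiM D_prob)

lemma prob_field_law: "prob_space (field_law \<alpha>)"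
  by (intro prob_space_PiM measure_pmf.prob_space_axioms)

lemma prob_law: "prob_space (law \<alpha>)"
  unfolding disorder_def by (intro prob_space_pair prob_coupling_law prob_field_law)

lemma sets_coupling_law: "sets coupling_law = sets (PiM (Pow {..<n}) (\<lambda>_. borel))"
  by (intro sets_PiM_cong D_borel) auto

lemma sets_law: "sets (law \<alpha>) = sets (disorder_space n)"
  unfolding disorder_def disorder_space_def
  by (intro sets_pair_measure_cong sets_coupling_law sets_PiM_cong) auto

lemma space_law: "space (law \<alpha>) = space (disorder_space n)"
  by (rule sets_eq_imp_space_eq[OF sets_law])

lemma measurable_law:
  assumes "(\<lambda>(h, \<omega>). f h \<omega>) \<in> borel_measurable (borel \<Otimes>\<^sub>M disorder_space n)"
  shows "f h \<in> borel_measurable (law \<alpha>)"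
  using measurable_Pair2[OF assms, of h] by (simp cong: measurable_cong_sets[OF sets_law refl])

lemma AE_law_nonneg: "AE \<omega> in law \<alpha>. \<forall>X\<in>Pow {..<n}. 0 \<le> fst \<omega> X"
proof -
  interpret F: prob_space "field_law \<alpha>" by (rule prob_field_law)
  have "AE J in coupling_law. \<forall>X\<in>Pow {..<n}. 0 \<le> J X"
    by (intro eventually_ball_finite ballI AE_PiM_component D_prob D_nonneg) auto
  then have "AE J in distr (coupling_law \<Otimes>\<^sub>M field_law \<alpha>) coupling_law fst. \<forall>X\<in>Pow {..<n}. 0 \<le> J X"
    by (subst F.distr_pair_fst)
  then show ?thesis unfolding disorder_def by (rule AE_distrD[rotated]) simp
qed

lemma associated_law:
  "associated (law \<alpha>) (\<lambda>x y. (\<forall>X\<in>Pow {..<n}. fst x X \<le> fst y X) \<and> (\<forall>i\<in>{..<n}. snd x i \<le> snd y i))"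
  unfolding disorder_def
  by (intro associated_pair harris_PiM prob_coupling_law prob_field_law D_prob
      measure_pmf.prob_space_axioms) auto

text \<open>The pressure is dominated by an affine function of the moduli of the couplings and of
  the fields, each of which has a finite second moment under its marginal law.\<close>

lemma pressure_square_integrable:
  assumes "0 < \<alpha>"
  shows "integrable (law \<alpha>) (\<lambda>\<omega>. pressure n (fst \<omega>) (snd \<omega>) h0 h1 ^ 2)"
proof -
  interpret F: prob_space "field_law \<alpha>" by (rule prob_field_law)
  interpret L: prob_space "law \<alpha>" by (rule prob_law)
  have J: "(\<lambda>\<omega>. fst \<omega> X) \<in> measurable (law \<alpha>) (D n X)"
    "integrable (law \<alpha>) (\<lambda>\<omega>. fst \<omega> X ^ 2)" if X: "X \<in> Pow {..<n}" for X
  proof -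
    have "distr (law \<alpha>) coupling_law fst = coupling_law"
      unfolding disorder_def by (rule F.distr_pair_fst)
    moreover have fst: "fst \<in> measurable (law \<alpha>) coupling_law" unfolding disorder_def by simp
    ultimately have "distr (law \<alpha>) (D n X) (\<lambda>\<omega>. fst \<omega> X) = D n X"
      using distr_PiM_component[of "Pow {..<n}" "D n" X] D_prob X
        distr_distr[of "\<lambda>J. J X" coupling_law "D n X" fst "law \<alpha>"] by (simp add: comp_def)
    moreover show m: "(\<lambda>\<omega>. fst \<omega> X) \<in> measurable (law \<alpha>) (D n X)"
      using measurable_compose[OF fst measurable_component_singleton[OF X]] .
    ultimately show "integrable (law \<alpha>) (\<lambda>\<omega>. fst \<omega> X ^ 2)"
      using integrable_distr[OF m, of "\<lambda>x. x ^ 2"] D_L2[OF X] by simp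
  qed
  have Jm: "(\<lambda>\<omega>. fst \<omega> X) \<in> borel_measurable (law \<alpha>)" if X: "X \<in> Pow {..<n}" for X
    using J(1)[OF X] by (simp cong: measurable_cong_sets[OF refl D_borel[OF X]])
  let ?q = "measure_pmf (poisson_pmf (\<alpha> * real n powr (\<theta> - 1)))"
  have T: "(\<lambda>\<omega>. real (snd \<omega> i)) \<in> borel_measurable (law \<alpha>)"
    "integrable (law \<alpha>) (\<lambda>\<omega>. real (snd \<omega> i) ^ 2)" if i: "i \<in> {..<n}" for i
  proof -
    have "distr (law \<alpha>) (field_law \<alpha>) snd = field_law \<alpha>"
      unfolding disorder_def by (rule distr_pair_snd[OF prob_coupling_law prob_field_law])
    moreover have snd: "snd \<in> measurable (law \<alpha>) (field_law \<alpha>)" unfolding disorder_def by simp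
    moreover have "distr (field_law \<alpha>) ?q (\<lambda>\<tau>. \<tau> i) = ?q"
      by (rule distr_PiM_component[OF measure_pmf.prob_space_axioms i])
    ultimately have "distr (law \<alpha>) ?q (\<lambda>\<omega>. snd \<omega> i) = ?q"
      using distr_distr[OF measurable_component_singleton[OF i] snd] by (simp add: comp_def)
    moreover have m: "(\<lambda>\<omega>. snd \<omega> i) \<in> measurable (law \<alpha>) ?q"
      using measurable_compose[OF snd measurable_component_singleton[OF i]] .
    ultimately show "integrable (law \<alpha>) (\<lambda>\<omega>. real (snd \<omega> i) ^ 2)"
      using integrable_distr[OF m, of "\<lambda>x. real x ^ 2"] assms n_pos
        poisson_square_integrable[of "\<alpha> * real n powr (\<theta> - 1)"] by simp
    show "(\<lambda>\<omega>. real (snd \<omega> i)) \<in> borel_measurable (law \<alpha>)"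
      by (rule measurable_compose[OF m]) simp
  qed
  define c where "c = (ln (real (card (spin_configs n))) + real n * \<bar>h0\<bar>) / real n"
  let ?B = "\<lambda>\<omega>. c + (\<Sum>X\<in>Pow {..<n}. \<bar>fst \<omega> X\<bar> / real n) + (\<Sum>i<n. \<bar>h1\<bar> / real n * real (snd \<omega> i))"
  show ?thesis
  proof (rule Bochner_Integration.integrable_bound)
    show "integrable (law \<alpha>) (\<lambda>\<omega>. ?B \<omega> ^ 2)"
      using Jm J(2) T
      by (intro square_integrable_add square_integrable_sum borel_measurable_add borel_measurable_sum
          borel_measurable_const borel_measurable_times borel_measurable_divide borel_measurable_abs)
         (auto simp: power_mult_distrib power_divide)
    show "(\<lambda>\<omega>. pressure n (fst \<omega>) (snd \<omega>) h0 h1 ^ 2) \<in> borel_measurable (law \<alpha>)"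
      by (intro borel_measurable_power measurable_law[OF measurable_pressure])
    show "AE \<omega> in law \<alpha>. norm (pressure n (fst \<omega>) (snd \<omega>) h0 h1 ^ 2) \<le> norm (?B \<omega> ^ 2)"
    proof (rule AE_I2)
      fix \<omega>
      have "\<bar>pressure n (fst \<omega>) (snd \<omega>) h0 h1\<bar> \<le> ?B \<omega>"
        using abs_pressure_le[of n "fst \<omega>" "snd \<omega>" h0 h1]
        by (simp add: c_def add_divide_distrib sum_divide_distrib sum_distrib_left)
      then have "\<bar>pressure n (fst \<omega>) (snd \<omega>) h0 h1\<bar> ^ 2 \<le> ?B \<omega> ^ 2" by (rule power_mono) simp
      then show "norm (pressure n (fst \<omega>) (snd \<omega>) h0 h1 ^ 2) \<le> norm (?B \<omega> ^ 2)" by simp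
    qed
  qed
qed

text \<open>Monotonicity of the Gibbs averages needs nonnegative couplings, which only hold almost surely;
  truncation makes it hold everywhere.\<close>
definition truncate :: "(nat set \<Rightarrow> real) \<times> (nat \<Rightarrow> nat) \<Rightarrow> (nat set \<Rightarrow> real) \<times> (nat \<Rightarrow> nat)" where
  "truncate \<omega> = (\<lambda>X\<in>Pow {..<n}. max 0 (fst \<omega> X), snd \<omega>)"

lemma measurable_truncate: "truncate \<in> measurable (disorder_space n) (disorder_space n)"
  unfolding truncate_def disorder_space_def
  by (intro measurable_Pair measurable_restrict borel_measurable_max borel_measurable_const
      measurable_compose[OF measurable_fst measurable_component_singleton] measurable_snd) auto

text \<open>Couplings are almost surely nonnegative, so the maximum changes nothing; points of the
  product space are extensional, so the restriction changes nothing either.\<close>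

lemma AE_truncate: "AE \<omega> in law \<alpha>. truncate \<omega> = \<omega>"
  using AE_law_nonneg AE_space
proof eventually_elim
  case (elim \<omega>)
  then have "fst \<omega> \<in> extensional (Pow {..<n})"
    unfolding space_law by (auto simp: disorder_space_def space_pair_measure space_PiM PiE_def)
  then show ?case
    using elim(1) by (intro prod_eqI) (auto simp: truncate_def extensional_def fun_eq_iff max_def)
qed

text \<open>Write k V = U + W with slack W. Both U and W are nondecreasing in the disorder, so
  Harris gives a nonnegative covariance, and k^2 Var V = Var U + Var W + 2 Cov(U, W) is at least Var
  U.\<close>

lemma overlap_variance_le:
  assumes "0 \<le> h0" "0 \<le> h1"
  shows "prob_space.variance (law \<alpha>) (\<lambda>\<omega>. gibbs n (fst \<omega>) (snd \<omega>) h0 h1 k (overlap n k))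
    \<le> real k ^ 2 * prob_space.variance (law \<alpha>) (\<lambda>\<omega>. magnetization n (fst \<omega>) (snd \<omega>) h1 h0)"
proof -
  define U where "U = (\<lambda>\<omega>. gibbs n (fst \<omega>) (snd \<omega>) h0 h1 k (overlap n k))"
  define V where "V = (\<lambda>\<omega>. magnetization n (fst \<omega>) (snd \<omega>) h1 h0)"
  interpret L: prob_space "law \<alpha>" by (rule prob_law)
  define W where "W \<omega> = real k * V \<omega> - U \<omega>" for \<omega>
  have mU [measurable]: "U \<in> borel_measurable (law \<alpha>)" "U \<in> borel_measurable (disorder_space n)"
    unfolding U_def by (rule measurable_law[OF measurable_gibbs])
      (use measurable_Pair2[OF measurable_gibbs, of h0] in simp)
  have mV [measurable]: "V \<in> borel_measurable (law \<alpha>)" "V \<in> borel_measurable (disorder_space n)"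
    unfolding V_def by (rule measurable_law[OF measurable_magnetization])
      (use measurable_Pair2[OF measurable_magnetization, of h0] in simp)
  have mW [measurable]: "W \<in> borel_measurable (law \<alpha>)" "W \<in> borel_measurable (disorder_space n)"
    unfolding W_def by measurable
  have bU: "\<bar>U \<omega>\<bar> \<le> 1" for \<omega> unfolding U_def by (rule abs_gibbs_overlap_le[OF n_pos])
  have bV: "\<bar>V \<omega>\<bar> \<le> 1" for \<omega> unfolding V_def by (rule abs_magnetization_le[OF n_pos])
  have bW: "\<bar>W \<omega>\<bar> \<le> real k + 1" for \<omega>
  proof -
    have "\<bar>real k * V \<omega>\<bar> \<le> real k * 1" unfolding abs_mult using bV[of \<omega>] by (intro mult_mono) auto
    then show ?thesis unfolding W_def using bU[of \<omega>] by linarith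
  qed
  have int [simp]: "integrable (law \<alpha>) U" "integrable (law \<alpha>) V" "integrable (law \<alpha>) W"
    using bU bV bW by (auto intro!: L.integrable_bounded)
  have int2 [simp]: "integrable (law \<alpha>) (\<lambda>\<omega>. U \<omega> ^ 2)" "integrable (law \<alpha>) (\<lambda>\<omega>. V \<omega> ^ 2)"
    using bU bV by (auto intro!: L.integrable_bounded[where B=1] simp: abs_square_le_1)
  have int3 [simp]: "integrable (law \<alpha>) (\<lambda>\<omega>. U \<omega> * W \<omega>)"
  proof (rule L.integrable_bounded[where B="1 * (real k + 1)"])
    show "\<bar>U \<omega> * W \<omega>\<bar> \<le> 1 * (real k + 1)" for \<omega>
      unfolding abs_mult by (rule mult_mono) (use bU bW in auto)
  qed measurable
  have int4 [simp]: "integrable (law \<alpha>) (\<lambda>\<omega>. W \<omega> ^ 2)"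
  proof (rule L.integrable_bounded[where B="(real k + 1) ^ 2"])
    show "\<bar>W \<omega> ^ 2\<bar> \<le> (real k + 1) ^ 2" for \<omega>
      using power_mono[OF bW, of \<omega> 2] by simp
  qed measurable
  note tm = measurable_truncate[THEN measurable_compose, THEN
      measurable_cong_sets[OF sets_law refl, THEN equalityD2, THEN subsetD], of _ borel \<alpha>]
  have mono: "U (truncate x) \<le> U (truncate y)" "W (truncate x) \<le> W (truncate y)"
    if le: "(\<forall>X\<in>Pow {..<n}. fst x X \<le> fst y X) \<and> (\<forall>i\<in>{..<n}. snd x i \<le> snd y i)" for x y
  proof -
    have 1: "\<forall>X\<in>Pow {..<n}. 0 \<le> fst (truncate x) X" by (simp add: truncate_def)
    have 2: "\<forall>X\<in>Pow {..<n}. fst (truncate x) X \<le> fst (truncate y) X"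
    proof
      fix X assume "X \<in> Pow {..<n}"
      then show "fst (truncate x) X \<le> fst (truncate y) X"
        using le max.mono[of 0 0 "fst x X" "fst y X"] by (simp add: truncate_def)
    qed
    have 3: "\<forall>i\<in>{..<n}. snd (truncate x) i \<le> snd (truncate y) i" using le by (simp add: truncate_def)
    show "U (truncate x) \<le> U (truncate y)" "W (truncate x) \<le> W (truncate y)"
      unfolding W_def U_def V_def using gibbs_overlap_mono[OF 1 assms 2 3] by auto
  qed
  have "L.expectation (\<lambda>\<omega>. U (truncate \<omega>)) * L.expectation (\<lambda>\<omega>. W (truncate \<omega>))
      \<le> L.expectation (\<lambda>\<omega>. U (truncate \<omega>) * W (truncate \<omega>))"
    by (rule associatedD[OF associated_law tm[OF mU(2)] tm[OF mW(2)] bU bW mono])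
  \<comment> \<open>Truncation is almost surely the identity, so the correlation inequality passes
    from the truncated to the original functions.\<close>
  moreover have tr: "L.expectation (\<lambda>\<omega>. f (truncate \<omega>)) = L.expectation f"
    if "f \<in> borel_measurable (disorder_space n)" for f :: "_ \<Rightarrow> real"
  proof (rule integral_cong_AE)
    show "f \<in> borel_measurable (law \<alpha>)"
      using that by (simp cong: measurable_cong_sets[OF sets_law refl])
    show "AE \<omega> in law \<alpha>. f (truncate \<omega>) = f \<omega>"
      using AE_truncate by eventually_elim simp
  qed (rule tm[OF that])
  ultimately have cov: "L.expectation U * L.expectation W \<le> L.expectation (\<lambda>\<omega>. U \<omega> * W \<omega>)"
    using tr[of "\<lambda>\<omega>. U \<omega> * W \<omega>"] by simp
  have eq: "V \<omega> * real k = U \<omega> + W \<omega>" for \<omega> by (simp add: W_def)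
  have "L.variance U \<le> L.variance U + L.variance W + 2 * (L.expectation (\<lambda>\<omega>. U \<omega> * W \<omega>) - L.expectation U * L.expectation W)"
    using cov L.variance_positive[of W] by simp
  also have "\<dots> = L.expectation (\<lambda>\<omega>. (U \<omega> + W \<omega>) ^ 2) - (L.expectation (\<lambda>\<omega>. U \<omega> + W \<omega>)) ^ 2"
  proof -
    have "L.expectation (\<lambda>\<omega>. (U \<omega> + W \<omega>) ^ 2) =
        L.expectation (\<lambda>\<omega>. U \<omega> ^ 2) + L.expectation (\<lambda>\<omega>. W \<omega> ^ 2) + 2 * L.expectation (\<lambda>\<omega>. U \<omega> * W \<omega>)"
      by (simp add: power2_sum mult.assoc)
    moreover have "(L.expectation (\<lambda>\<omega>. U \<omega> + W \<omega>)) ^ 2 = (L.expectation U) ^ 2 + (L.expectation W) ^ 2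
        + 2 * (L.expectation U * L.expectation W)"
      by (simp add: power2_sum)
    ultimately show ?thesis by (simp add: L.variance_eq)
  qed
  also have "\<dots> = real k ^ 2 * L.variance V"
    unfolding eq[symmetric] by (simp add: L.variance_eq power_mult_distrib algebra_simps)
  finally show ?thesis unfolding U_def V_def .
qed

text \<open>The dominating function after the AM-GM step. It involves the parameters only through a
  mean thermal variance and a disorder variance, for which joint measurability in \<open>h0\<close>
  and \<alpha> and boundedness can be shown, as Fubini requires.\<close>

definition bound :: "nat \<Rightarrow> nat \<Rightarrow> real \<Rightarrow> real \<Rightarrow> real \<Rightarrow> real \<Rightarrow> real" where
  "bound p k h1 \<epsilon> h0 \<alpha> = real p * ((real k * (\<integral>\<omega>. thermal_var n (fst \<omega>) (snd \<omega>) h1 h0 \<partial>law \<alpha>)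
     + real k ^ 2 * prob_space.variance (law \<alpha>) (\<lambda>\<omega>. magnetization n (fst \<omega>) (snd \<omega>) h1 h0))
     / (2 * \<epsilon>) + \<epsilon> / 2)"

lemma overlap_deviation_le_bound:
  assumes "0 \<le> h0" "0 \<le> h1" "0 < \<epsilon>"
  shows "Edis D \<theta> n \<alpha> (\<lambda>J \<tau>. gibbs n J \<tau> h0 h1 k (\<lambda>s. \<bar>overlap n k s ^ p
      - (Edis D \<theta> n \<alpha> (\<lambda>J' \<tau>'. gibbs n J' \<tau>' h0 h1 k (overlap n k))) ^ p\<bar>))
    \<le> bound p k h1 \<epsilon> h0 \<alpha>"
proof -
  interpret L: prob_space "law \<alpha>" by (rule prob_law)
  define U where "U \<omega> = gibbs n (fst \<omega>) (snd \<omega>) h0 h1 k (overlap n k)" for \<omega>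
  define Q where "Q \<omega> = gibbs n (fst \<omega>) (snd \<omega>) h0 h1 k (\<lambda>s. overlap n k s ^ 2)" for \<omega>
  define T where "T \<omega> = thermal_var n (fst \<omega>) (snd \<omega>) h1 h0" for \<omega>
  define c where "c = L.expectation U"
  have c: "Edis D \<theta> n \<alpha> (\<lambda>J' \<tau>'. gibbs n J' \<tau>' h0 h1 k (overlap n k)) = c"
    by (simp add: Edis_def c_def U_def[abs_def])
  have [measurable]: "U \<in> borel_measurable (law \<alpha>)" "Q \<in> borel_measurable (law \<alpha>)"
    "T \<in> borel_measurable (law \<alpha>)"
    unfolding U_def Q_def T_def
    by (rule measurable_law[OF measurable_gibbs] measurable_law[OF measurable_thermal_var])+
  have bU: "\<bar>U \<omega>\<bar> \<le> 1" for \<omega> unfolding U_def by (rule abs_gibbs_overlap_le[OF n_pos])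
  have bQ: "\<bar>Q \<omega>\<bar> \<le> 1" for \<omega> unfolding Q_def by (rule abs_gibbs_overlap_square_le[OF n_pos])
  have bT: "\<bar>T \<omega>\<bar> \<le> 1" for \<omega>
    unfolding T_def using thermal_var_nonneg[of n] thermal_var_le[OF n_pos] by (simp add: abs_le_iff)
  have int [simp]: "integrable (law \<alpha>) U" "integrable (law \<alpha>) Q" "integrable (law \<alpha>) T"
    using bU bQ bT by (auto intro!: L.integrable_bounded)
  have int2 [simp]: "integrable (law \<alpha>) (\<lambda>\<omega>. U \<omega> ^ 2)"
    using bU by (auto intro!: L.integrable_bounded[where B=1] simp: abs_square_le_1)
  have c1: "\<bar>c\<bar> \<le> 1" unfolding c_def by (rule L.abs_expectation_le[OF bU])
  let ?R = "\<lambda>\<omega>. real p * ((U \<omega> ^ 2 + real k * T \<omega> - 2 * c * U \<omega> + c ^ 2) / (2 * \<epsilon>) + \<epsilon> / 2)"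
  have "Edis D \<theta> n \<alpha> (\<lambda>J \<tau>. gibbs n J \<tau> h0 h1 k (\<lambda>s. \<bar>overlap n k s ^ p - c ^ p\<bar>)) \<le> L.expectation ?R"
    unfolding Edis_def
  \<comment> \<open>The upper function alone has to be integrable, since it is nonnegative and a
    nonexistent integral counts as 0.\<close>
  proof (rule integral_mono_AE')
    show "AE \<omega> in law \<alpha>. gibbs n (fst \<omega>) (snd \<omega>) h0 h1 k (\<lambda>s. \<bar>overlap n k s ^ p - c ^ p\<bar>) \<le> ?R \<omega>"
      using AE_law_nonneg
    proof eventually_elim
      case (elim \<omega>)
      have "gibbs n (fst \<omega>) (snd \<omega>) h0 h1 k (\<lambda>s. \<bar>overlap n k s ^ p - c ^ p\<bar>)
        \<le> real p * ((Q \<omega> - 2 * c * U \<omega> + c ^ 2) / (2 * \<epsilon>) + \<epsilon> / 2)"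
        unfolding Q_def U_def by (rule gibbs_abs_power_diff_le[OF n_pos c1 assms(3)])
      also have "\<dots> \<le> ?R \<omega>"
        using gibbs_overlap_variance_le[OF elim assms(1,2), of "snd \<omega>" k] assms(3)
        by (intro mult_left_mono add_right_mono divide_right_mono) (auto simp: Q_def U_def T_def)
      finally show ?case .
    qed
    show "AE \<omega> in law \<alpha>. 0 \<le> ?R \<omega>"
    proof (rule AE_I2)
      fix \<omega>
      have "0 \<le> (U \<omega> - c) ^ 2 + real k * T \<omega>"
        using thermal_var_nonneg[of n] by (simp add: T_def)
      also have "\<dots> = U \<omega> ^ 2 + real k * T \<omega> - 2 * c * U \<omega> + c ^ 2"
        by (simp add: power2_diff)
      finally show "0 \<le> ?R \<omega>" using assms(3) by simp
    qed
  qed simp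
  also have "\<dots> = real p * ((L.expectation (\<lambda>\<omega>. U \<omega> ^ 2) + real k * L.expectation T - 2 * c * c + c ^ 2) / (2 * \<epsilon>) + \<epsilon> / 2)"
    by (simp add: L.prob_space c_def)
  \<comment> \<open>With c = E U the terms E U^2 - 2 c E U + c^2 collapse to the disorder variance
    of U.\<close>
  also have "\<dots> = real p * ((real k * L.expectation T + L.variance U) / (2 * \<epsilon>) + \<epsilon> / 2)"
  proof -
    have "L.expectation (\<lambda>\<omega>. U \<omega> ^ 2) + real k * L.expectation T - 2 * c * c + c ^ 2 =
        real k * L.expectation T + L.variance U"
      using L.variance_eq[OF int(1) int2] by (simp add: c_def[symmetric] power2_eq_square[of c])
    then show ?thesis by (simp only:)
  qed
  also have "\<dots> \<le> bound p k h1 \<epsilon> h0 \<alpha>"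
    unfolding bound_def using overlap_variance_le[OF assms(1,2), of \<alpha> k] assms(3)
    by (intro mult_left_mono add_right_mono divide_right_mono) (auto simp: U_def[abs_def] T_def[abs_def])
  finally show ?thesis unfolding c .
qed

lemma law_kernel:
  assumes "0 < a"
  shows "(\<lambda>\<alpha>. law (max a \<alpha>)) \<in> measurable borel (subprob_algebra (disorder_space n))"
proof -
  have "(\<lambda>\<alpha>. law (max a \<alpha>)) \<in> measurable borel (prob_algebra (disorder_space n))"
    unfolding disorder_def disorder_space_def
  proof (intro measurable_pair_prob)
    show "(\<lambda>\<alpha>. coupling_law) \<in> measurable borel (prob_algebra (PiM (Pow {..<n}) (\<lambda>_. borel)))"
      using prob_coupling_law sets_coupling_law by (intro measurable_const) (simp add: space_prob_algebra)
    \<comment> \<open>The maximum with a > 0 keeps the Poisson rate positive for every real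
      \<alpha>, so the family is a kernel on the whole line; it agrees with the given law when
      \<alpha> is at least a.\<close>
    show "(\<lambda>\<alpha>. field_law (max a \<alpha>)) \<in> measurable borel (prob_algebra (PiM {..<n} (\<lambda>_. count_space UNIV)))"
      using assms n_pos by (intro poisson_PiM_kernel) (auto simp: less_max_iff_disj)
  qed
  then show ?thesis by (rule measurable_prob_algebraD)
qed

lemma expectation_law_measurable:
  fixes f :: "real \<Rightarrow> (nat set \<Rightarrow> real) \<times> (nat \<Rightarrow> nat) \<Rightarrow> real"
  assumes "(\<lambda>(h, \<omega>). f h \<omega>) \<in> borel_measurable (borel \<Otimes>\<^sub>M disorder_space n)" "0 < a"
  shows "(\<lambda>(h, \<alpha>). \<integral>\<omega>. f h \<omega> \<partial>law (max a \<alpha>)) \<in> borel_measurable (borel \<Otimes>\<^sub>M borel)"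
proof -
  have "(\<lambda>x. \<integral>\<omega>. f (fst x) \<omega> \<partial>law (max a (snd x))) \<in> borel_measurable (borel \<Otimes>\<^sub>M borel)"
  proof (rule integral_kernel_measurable[where f="\<lambda>x. f (fst x)" and L="\<lambda>x. law (max a (snd x))"])
    have "(\<lambda>x. (fst (fst x), snd x)) \<in> measurable ((borel \<Otimes>\<^sub>M borel) \<Otimes>\<^sub>M disorder_space n) (borel \<Otimes>\<^sub>M disorder_space n)"
      by measurable
    from measurable_compose[OF this assms(1)]
    show "(\<lambda>(x, \<omega>). f (fst x) \<omega>) \<in> borel_measurable ((borel \<Otimes>\<^sub>M borel) \<Otimes>\<^sub>M disorder_space n)"
      by (simp add: case_prod_beta')
    show "(\<lambda>x. law (max a (snd x))) \<in> measurable (borel \<Otimes>\<^sub>M borel) (subprob_algebra (disorder_space n))"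
      by (rule measurable_compose[OF measurable_snd law_kernel[OF assms(2)]])
  qed
  then show ?thesis by (simp add: case_prod_beta)
qed

lemma magnetization_variance_eq:
  "prob_space.variance (law \<alpha>) (\<lambda>\<omega>. magnetization n (fst \<omega>) (snd \<omega>) h1 h0) =
    (\<integral>\<omega>. magnetization n (fst \<omega>) (snd \<omega>) h1 h0 ^ 2 \<partial>law \<alpha>)
    - (\<integral>\<omega>. magnetization n (fst \<omega>) (snd \<omega>) h1 h0 \<partial>law \<alpha>) ^ 2"
proof -
  interpret L: prob_space "law \<alpha>" by (rule prob_law)
  show ?thesis
    using abs_magnetization_le[OF n_pos] measurable_law[OF measurable_magnetization]
    by (intro L.variance_eq L.integrable_bounded[where B=1] borel_measurable_power)
       (auto simp: abs_square_le_1)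
qed

lemma
  shows expectation_thermal_var: "0 \<le> (\<integral>\<omega>. thermal_var n (fst \<omega>) (snd \<omega>) h1 h0 \<partial>law \<alpha>)"
    "(\<integral>\<omega>. thermal_var n (fst \<omega>) (snd \<omega>) h1 h0 \<partial>law \<alpha>) \<le> 1"
  and magnetization_variance: "0 \<le> prob_space.variance (law \<alpha>) (\<lambda>\<omega>. magnetization n (fst \<omega>) (snd \<omega>) h1 h0)"
    "prob_space.variance (law \<alpha>) (\<lambda>\<omega>. magnetization n (fst \<omega>) (snd \<omega>) h1 h0) \<le> 1"
proof -
  interpret L: prob_space "law \<alpha>" by (rule prob_law)
  show "0 \<le> (\<integral>\<omega>. thermal_var n (fst \<omega>) (snd \<omega>) h1 h0 \<partial>law \<alpha>)"
    by (rule integral_nonneg_AE) (simp add: thermal_var_nonneg)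
  have "\<bar>\<integral>\<omega>. thermal_var n (fst \<omega>) (snd \<omega>) h1 h0 \<partial>law \<alpha>\<bar> \<le> 1"
    by (rule L.abs_expectation_le) (simp add: thermal_var_nonneg thermal_var_le[OF n_pos])
  then show "(\<integral>\<omega>. thermal_var n (fst \<omega>) (snd \<omega>) h1 h0 \<partial>law \<alpha>) \<le> 1" by simp
  show "0 \<le> L.variance (\<lambda>\<omega>. magnetization n (fst \<omega>) (snd \<omega>) h1 h0)"
    by (rule L.variance_positive)
  have "\<bar>\<integral>\<omega>. magnetization n (fst \<omega>) (snd \<omega>) h1 h0 ^ 2 \<partial>law \<alpha>\<bar> \<le> 1"
    using abs_magnetization_le[OF n_pos] by (intro L.abs_expectation_le) (simp add: abs_square_le_1)
  then show "L.variance (\<lambda>\<omega>. magnetization n (fst \<omega>) (snd \<omega>) h1 h0) \<le> 1"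
    unfolding magnetization_variance_eq
    using zero_le_power2[of "\<integral>\<omega>. magnetization n (fst \<omega>) (snd \<omega>) h1 h0 \<partial>law \<alpha>"] by linarith
qed

lemma thermal_var_measurable:
  assumes "0 < a"
  shows "(\<lambda>(h0, \<alpha>). \<integral>\<omega>. thermal_var n (fst \<omega>) (snd \<omega>) h1 h0 \<partial>law (max a \<alpha>)) \<in> borel_measurable (borel \<Otimes>\<^sub>M borel)"
  by (rule expectation_law_measurable[OF measurable_thermal_var assms])

lemma magnetization_variance_measurable:
  assumes "0 < a"
  shows "(\<lambda>(h0, \<alpha>). prob_space.variance (law (max a \<alpha>)) (\<lambda>\<omega>. magnetization n (fst \<omega>) (snd \<omega>) h1 h0))
     \<in> borel_measurable (borel \<Otimes>\<^sub>M borel)"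
proof -
  have "(\<lambda>(h0, \<omega>). magnetization n (fst \<omega>) (snd \<omega>) h1 h0 ^ 2) \<in> borel_measurable (borel \<Otimes>\<^sub>M disorder_space n)"
    using borel_measurable_power[OF measurable_magnetization, of n h1 2] by (simp add: case_prod_beta)
  note 1 = expectation_law_measurable[OF this assms]
    and 2 = expectation_law_measurable[OF measurable_magnetization assms, of h1]
  show ?thesis
    unfolding magnetization_variance_eq case_prod_beta
    by (intro borel_measurable_diff borel_measurable_power) (use 1 2 in \<open>auto simp: case_prod_beta\<close>)
qed

lemma bound_measurable:
  assumes "0 < a"
  shows "(\<lambda>(h0, \<alpha>). bound p k h1 \<epsilon> h0 (max a \<alpha>)) \<in> borel_measurable (borel \<Otimes>\<^sub>M borel)"
  unfolding bound_def case_prod_beta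
  by (intro borel_measurable_times borel_measurable_add borel_measurable_divide borel_measurable_const)
     (use thermal_var_measurable[OF assms] magnetization_variance_measurable[OF assms] in
       \<open>auto simp: case_prod_beta\<close>)

lemma bound_nonneg: "0 < \<epsilon> \<Longrightarrow> 0 \<le> bound p k h1 \<epsilon> h0 \<alpha>"
  unfolding bound_def using expectation_thermal_var(1) magnetization_variance(1) by simp

lemma bound_le: "0 < \<epsilon> \<Longrightarrow> bound p k h1 \<epsilon> h0 \<alpha> \<le> real p * ((real k * 1 + real k ^ 2 * 1) / (2 * \<epsilon>) + \<epsilon> / 2)"
  unfolding bound_def using expectation_thermal_var(2) magnetization_variance(2)
  by (intro mult_left_mono add_mono divide_right_mono) auto

end

section \<open>Concentration of the multi-overlaps\<close>

text \<open>\<open>A\<close> enters only through pointwise domination by \<open>G\<close>. Since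
  \<open>G\<close> is nonnegative, bounded and jointly measurable, Fubini swaps the order of
  integration, so a bound on the x-integral uniform in y suffices.\<close>

lemma iterated_interval_integral_le:
  fixes A G :: "real \<Rightarrow> real \<Rightarrow> real"
  assumes "lo \<le> hi" "a \<le> b"
    and meas: "case_prod G \<in> borel_measurable (borel \<Otimes>\<^sub>M borel)"
    and bd: "\<And>x y. 0 \<le> G x y" "\<And>x y. G x y \<le> K"
    and le: "\<And>x y. x \<in> {lo..hi} \<Longrightarrow> y \<in> {a..b} \<Longrightarrow> A x y \<le> G x y"
    and inner: "\<And>y. y \<in> {a..b} \<Longrightarrow> (\<integral>x. G x y \<partial>restrict_space lborel {lo..hi}) \<le> B"
  shows "(LBINT x=lo..hi. (LBINT y=a..b. A x y)) \<le> B * (b - a)"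
proof -
  let ?L = "restrict_space lborel {lo..hi}" and ?M = "restrict_space lborel {a..b}"
  interpret L: finite_measure ?L by (rule finite_measure_restrict_interval)
  interpret M: finite_measure ?M by (rule finite_measure_restrict_interval)
  interpret P: pair_sigma_finite ?L ?M ..
  have conv: "(LBINT x=u..v. f x) = (\<integral>x. f x \<partial>restrict_space lborel {u..v})" if "u \<le> v" for u v and f :: "real \<Rightarrow> real"
    using that by (simp add: interval_integral_Icc integral_restrict_space set_lebesgue_integral_def)
  have "(\<lambda>x. (fst x, snd x)) \<in> measurable (?L \<Otimes>\<^sub>M ?M) (borel \<Otimes>\<^sub>M borel)"
    by (intro measurable_Pair measurable_compose[OF measurable_fst measurable_restrict_space1]
        measurable_compose[OF measurable_snd measurable_restrict_space1]) auto
  from measurable_compose[OF this meas] have m: "case_prod G \<in> borel_measurable (?L \<Otimes>\<^sub>M ?M)" by simp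
  have fin: "finite_measure (?L \<Otimes>\<^sub>M ?M)"
    using L.finite_measure_axioms M.finite_measure_axioms by (intro finite_measure_pair_measure)
  have int: "integrable (?L \<Otimes>\<^sub>M ?M) (case_prod G)"
    using bd m by (intro finite_measure.integrable_const_bound[OF fin, of _ K]) auto
  have intx: "integrable ?M (G x)" for x
  proof -
    have "G x \<in> borel_measurable ?M"
      using measurable_Pair2[OF meas, of x] by (intro measurable_restrict_space1) simp
    then show ?thesis using bd by (intro M.integrable_const_bound[of _ K]) auto
  qed
  have "(LBINT x=lo..hi. (LBINT y=a..b. A x y)) = (\<integral>x. (\<integral>y. A x y \<partial>?M) \<partial>?L)"
    using assms(1,2) by (simp add: conv)
  also have "\<dots> \<le> (\<integral>x. (\<integral>y. G x y \<partial>?M) \<partial>?L)"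
  proof (rule integral_mono')
    show "integrable ?L (\<lambda>x. \<integral>y. G x y \<partial>?M)"
      using P.integrable_fst'[OF int] by simp
    show "(\<integral>y. A x y \<partial>?M) \<le> (\<integral>y. G x y \<partial>?M)" if "x \<in> space ?L" for x
      using that le bd intx by (intro integral_mono') (auto simp: space_restrict_space)
    show "0 \<le> (\<integral>y. G x y \<partial>?M)" for x using bd by (intro integral_nonneg_AE) auto
  qed
  also have "\<dots> = (\<integral>y. (\<integral>x. G x y \<partial>?L) \<partial>?M)"
    using P.Fubini_integral[OF int] by simp
  also have "\<dots> \<le> (\<integral>y. B \<partial>?M)"
  proof (rule integral_mono)
    show "integrable ?M (\<lambda>y. \<integral>x. G x y \<partial>?L)"
      using P.integrable_snd[OF int] by simp
  qed (use inner in \<open>auto simp: space_restrict_space\<close>)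
  also have "\<dots> = B * (b - a)"
    using assms(2) by (simp add: space_restrict_space measure_restrict_space)
  finally show ?thesis .
qed

text \<open>Needed to identify the Lebesgue integral of the derivative of the magnetization with its
  increment.\<close>

lemma continuous_thermal_var: "continuous_on UNIV (thermal_var n J \<tau> h1)"
proof -
  have g: "continuous_on UNIV (\<lambda>h0. gibbs1 n J \<tau> h0 h1 f)" for f
  proof -
    have "continuous_on UNIV (\<lambda>h0. \<Sum>\<sigma>\<in>spin_configs n. f \<sigma> * exp (- hamiltonian n J \<tau> h0 h1 \<sigma>))"
      by (intro continuous_at_imp_continuous_on ballI DERIV_isCont[OF DERIV_gibbs_sum])
    moreover have "continuous_on UNIV (\<lambda>h0. partition_fun n J \<tau> h0 h1)"
      by (intro continuous_at_imp_continuous_on ballI DERIV_isCont[OF DERIV_partition_fun])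
    ultimately show ?thesis
      unfolding gibbs1_def using partition_fun_pos[of n J \<tau> _ h1]
      by (intro continuous_on_divide) (auto simp: less_imp_neq[symmetric])
  qed
  show ?thesis
    unfolding thermal_var_def[abs_def] magnetization_def by (intro continuous_intros g)
qed

text \<open>The thermal part integrates to the increment of a mean magnetization divided by n, at
  most 2/n; the disorder part is controlled by the convexity estimate applied to the
  pressure.\<close>

lemma (in disorder_model) integral_bound_le:
  assumes "0 < \<alpha>" "0 < \<epsilon>" "lo \<le> hi" "hi - lo \<le> 1" and d: "0 < d" "0 < lo - d" "hi + d < 1"
    and "0 \<le> c"
    and conc: "\<And>h0. 0 < h0 \<Longrightarrow> h0 < 1 \<Longrightarrow>
      prob_space.variance (law \<alpha>) (\<lambda>\<omega>. pressure n (fst \<omega>) (snd \<omega>) h0 h1) \<le> c"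
  shows "(\<integral>h0. bound p k h1 \<epsilon> h0 \<alpha> \<partial>restrict_space lborel {lo..hi}) \<le>
    real p * ((real k * (2 / real n) + real k ^ 2 * (6 * sqrt c / d + 8 * d)) / (2 * \<epsilon>) + \<epsilon> / 2)"
proof -
  let ?L = "restrict_space lborel {lo..hi}"
  interpret L: finite_measure ?L by (rule finite_measure_restrict_interval)
  interpret \<mu>: prob_space "law \<alpha>" by (rule prob_law)
  define T where "T h = (\<integral>\<omega>. thermal_var n (fst \<omega>) (snd \<omega>) h1 h \<partial>law \<alpha>)" for h
  define V where "V h = \<mu>.variance (\<lambda>\<omega>. magnetization n (fst \<omega>) (snd \<omega>) h1 h)" for h
  have "T \<in> borel_measurable borel" "V \<in> borel_measurable borel"
    \<comment> \<open>The kernel statement is used with threshold \<alpha> at the point \<alpha>,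
      where the maximum is \<alpha>.\<close>
    using measurable_Pair1[OF thermal_var_measurable[OF \<open>0 < \<alpha>\<close>], of \<alpha> h1]
      measurable_Pair1[OF magnetization_variance_measurable[OF \<open>0 < \<alpha>\<close>], of \<alpha> h1]
    by (simp_all add: T_def[abs_def] V_def[abs_def])
  then have "T \<in> borel_measurable ?L" "V \<in> borel_measurable ?L"
    by (auto intro: measurable_restrict_space1)
  then have int [simp]: "integrable ?L T" "integrable ?L V"
    using expectation_thermal_var magnetization_variance unfolding T_def[abs_def] V_def[abs_def]
    by (auto intro!: L.integrable_const_bound[of _ 1])
  have T: "(\<integral>h. T h \<partial>?L) \<le> 2 / real n"
    unfolding T_def
  proof (rule \<mu>.integral_derivative_le)
    show "((\<lambda>h. magnetization n (fst \<omega>) (snd \<omega>) h1 h) has_real_derivative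
        real n * thermal_var n (fst \<omega>) (snd \<omega>) h1 h) (at h)" for h \<omega>
      by (rule DERIV_magnetization[OF n_pos])
    show "\<bar>thermal_var n (fst \<omega>) (snd \<omega>) h1 h\<bar> \<le> 1" for h \<omega>
      by (simp add: thermal_var_nonneg thermal_var_le[OF n_pos])
    have "sets (borel \<Otimes>\<^sub>M law \<alpha>) = sets (borel \<Otimes>\<^sub>M disorder_space n)"
      by (intro sets_pair_measure_cong refl sets_law)
    then show "(\<lambda>(h, \<omega>). thermal_var n (fst \<omega>) (snd \<omega>) h1 h) \<in> borel_measurable (borel \<Otimes>\<^sub>M law \<alpha>)"
      using measurable_thermal_var[of n h1] measurable_cong_sets by blast
  qed (use abs_magnetization_le[OF n_pos] continuous_thermal_var n_pos assms in auto)
  have "(\<integral>h. V h \<partial>?L) \<le> 6 * sqrt c / d * (hi - lo) + 8 * d"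
    unfolding V_def
    by (rule \<mu>.convex_derivative_variance[OF DERIV_pressure magnetization_mono[OF n_pos] abs_magnetization_le[OF n_pos]
       measurable_law[OF measurable_pressure] measurable_law[OF measurable_magnetization]
       pressure_square_integrable[OF \<open>0 < \<alpha>\<close>] conc d \<open>lo \<le> hi\<close>])
  also have "\<dots> \<le> 6 * sqrt c / d * 1 + 8 * d"
    using assms by (intro add_right_mono mult_left_mono) auto
  finally have V: "(\<integral>h. V h \<partial>?L) \<le> 6 * sqrt c / d + 8 * d" by simp
  have "(\<integral>h0. bound p k h1 \<epsilon> h0 \<alpha> \<partial>?L) =
      (\<integral>h0. real p * ((real k * T h0 + real k ^ 2 * V h0) / (2 * \<epsilon>) + \<epsilon> / 2) \<partial>?L)"
    by (simp add: bound_def T_def V_def)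
  also have "\<dots> = real p * ((real k * (\<integral>h. T h \<partial>?L) + real k ^ 2 * (\<integral>h. V h \<partial>?L)) / (2 * \<epsilon>) + \<epsilon> / 2 * (hi - lo))"
    using assms(3) by (simp add: space_restrict_space measure_restrict_space)
  also have "\<dots> \<le> real p * ((real k * (2 / real n) + real k ^ 2 * (6 * sqrt c / d + 8 * d)) / (2 * \<epsilon>) + \<epsilon> / 2 * 1)"
    using T V assms by (intro mult_left_mono add_mono divide_right_mono) auto
  finally show ?thesis by simp
qed

text \<open>Here the step is n^(-1/4) and the AM-GM parameter is n^(-1/8). The four resulting terms
  have orders n^(-7/8), n^(-1/8), n^(-1/8) and n^(-1/8); each tends to 0 after multiplication by
  n^(1/16), so any positive constant \<open>R\<close> eventually dominates.\<close>

lemma eventually_rate_le: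
  fixes R P K C s :: real
  assumes "0 < R" "s \<le> 1 / 16"
  shows "eventually (\<lambda>n. P * ((K * (2 / real n) + K ^ 2 * (6 * sqrt (C / real n) / real n powr (-1/4)
     + 8 * real n powr (-1/4))) / (2 * real n powr (-1/8)) + real n powr (-1/8) / 2)
     \<le> R / real n powr s) sequentially"
proof -
  define f where "f n = P * ((K * (2 / real n) + K ^ 2 * (6 * sqrt (C / real n) / real n powr (-1/4)
     + 8 * real n powr (-1/4))) / (2 * real n powr (-1/8)) + real n powr (-1/8) / 2)" for n
  have l: "(\<lambda>n. (1 / real n) / real n powr (-1/8) * real n powr (1/16)) \<longlonglongrightarrow> 0"
    "(\<lambda>n. 1 / sqrt (real n) / real n powr (-1/4) / real n powr (-1/8) * real n powr (1/16)) \<longlonglongrightarrow> 0"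
    "(\<lambda>n. real n powr (-1/4) / real n powr (-1/8) * real n powr (1/16)) \<longlonglongrightarrow> 0"
    "(\<lambda>n. real n powr (-1/8) * real n powr (1/16)) \<longlonglongrightarrow> 0"
    by real_asymp+
  have "(\<lambda>n. P * K * ((1 / real n) / real n powr (-1/8) * real n powr (1/16))
     + 3 * P * K ^ 2 * sqrt C * (1 / sqrt (real n) / real n powr (-1/4) / real n powr (-1/8) * real n powr (1/16))
     + 4 * P * K ^ 2 * (real n powr (-1/4) / real n powr (-1/8) * real n powr (1/16))
     + P / 2 * (real n powr (-1/8) * real n powr (1/16))) \<longlonglongrightarrow> 0"
    by (rule tendsto_eq_intros l refl | simp)+
  also have "(\<lambda>n. P * K * ((1 / real n) / real n powr (-1/8) * real n powr (1/16))
     + 3 * P * K ^ 2 * sqrt C * (1 / sqrt (real n) / real n powr (-1/4) / real n powr (-1/8) * real n powr (1/16))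
     + 4 * P * K ^ 2 * (real n powr (-1/4) / real n powr (-1/8) * real n powr (1/16))
     + P / 2 * (real n powr (-1/8) * real n powr (1/16))) = (\<lambda>n. f n * real n powr (1/16))"
    unfolding f_def real_sqrt_divide by (simp add: fun_eq_iff algebra_simps add_divide_distrib)
  finally have "eventually (\<lambda>n. f n * real n powr (1/16) < R) sequentially"
    using assms(1) by (rule order_tendstoD)
  moreover have "eventually (\<lambda>n::nat. 1 \<le> n) sequentially" by (rule eventually_ge_at_top)
  ultimately show ?thesis
    unfolding f_def[symmetric]
  proof eventually_elim
    case (elim n)
    then have "f n \<le> R / real n powr (1/16)" by (simp add: field_simps)
    also have "\<dots> \<le> R / real n powr s"
      using elim assms by (intro divide_left_mono powr_mono mult_pos_pos) auto
    finally show ?case .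
  qed
qed

theorem theorem3p8:
  fixes \<theta> h_lo h_hi a_lo a_hi h1 C C_P :: real
    and k p :: nat
    and D :: "nat \<Rightarrow> nat set \<Rightarrow> real measure"
  assumes theta: "1/2 < \<theta>" "\<theta> \<le> 7/8"
    and hrange: "0 < h_lo" "h_lo \<le> h_hi" "h_hi < 1"
    and arange: "0 < a_lo" "a_lo \<le> a_hi" "a_hi < 1"
    and h1: "0 < h1" "h1 \<le> 1"
    and k: "1 \<le> k" and p: "2 \<le> p"
    and D_prob: "\<And>n X. X \<in> Pow {..<n} \<Longrightarrow> prob_space (D n X)"
    and D_borel: "\<And>n X. X \<in> Pow {..<n} \<Longrightarrow> sets (D n X) = sets borel"
    and D_nonneg: "\<And>n X. X \<in> Pow {..<n} \<Longrightarrow> AE x in D n X. 0 \<le> x"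
    and D_L2: "\<And>n X. X \<in> Pow {..<n} \<Longrightarrow> integrable (D n X) (\<lambda>x. x ^ 2)"
    and var_sum: "\<And>n. (\<Sum>X\<in>Pow {..<n}.
          (\<integral>x. (x - (\<integral>y. y \<partial>D n X)) ^ 2 \<partial>D n X)) \<le> C * real n"
    and C_P: "0 < C_P"
    and press_conc: "\<And>n h0 \<alpha> h1'. 1 \<le> n \<Longrightarrow> 0 < h0 \<Longrightarrow> h0 < 1 \<Longrightarrow> 0 < \<alpha> \<Longrightarrow> \<alpha> < 1
          \<Longrightarrow> 0 < h1' \<Longrightarrow> h1' \<le> 1 \<Longrightarrow>
          Edis D \<theta> n \<alpha> (\<lambda>J \<tau>. (pressure n J \<tau> h0 h1'
              - Edis D \<theta> n \<alpha> (\<lambda>J' \<tau>'. pressure n J' \<tau>' h0 h1')) ^ 2) \<le> C_P / real n"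
  shows "\<exists>N. \<forall>n\<ge>N.
     (LBINT h0=h_lo..h_hi. (LBINT \<alpha>=a_lo..a_hi.
        Edis D \<theta> n \<alpha> (\<lambda>J \<tau>. gibbs n J \<tau> h0 h1 k
          (\<lambda>s. \<bar>overlap n k s ^ p
                 - (Edis D \<theta> n \<alpha> (\<lambda>J' \<tau>'. gibbs n J' \<tau>' h0 h1 k (overlap n k))) ^ p\<bar>))))
     \<le> 2 * real p * real k / (tanh h1) powr (real k / 2)
        * (5 * C_P + 40) powr (1/4) / real n powr ((\<theta> - 1/2) / 6)"
proof -
  define R where "R = 2 * real p * real k / (tanh h1) powr (real k / 2) * (5 * C_P + 40) powr (1/4)"
  have R: "0 < R"
    unfolding R_def using k p C_P h1 by (intro mult_pos_pos divide_pos_pos) auto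
  \<comment> \<open>At \<theta> = 7/8 the exponent equals exactly 1/16.\<close>
  have s: "(\<theta> - 1/2) / 6 \<le> 1 / 16" using theta by simp
  \<comment> \<open>For large n the difference quotients stay inside (0, 1), where the pressure is
    known to concentrate.\<close>
  have "eventually (\<lambda>n. real n powr (-1/4) < h_lo) sequentially"
    by (rule order_tendstoD[OF _ hrange(1)]) real_asymp
  moreover have "eventually (\<lambda>n. real n powr (-1/4) < 1 - h_hi) sequentially"
    by (rule order_tendstoD[of _ 0]; (real_asymp | use hrange in simp))
  moreover have "eventually (\<lambda>n::nat. 1 \<le> n) sequentially" by (rule eventually_ge_at_top)
  moreover note eventually_rate_le[OF R s, of "real p" "real k" C_P]
  ultimately have "eventually (\<lambda>n.
     (LBINT h0=h_lo..h_hi. (LBINT \<alpha>=a_lo..a_hi.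
        Edis D \<theta> n \<alpha> (\<lambda>J \<tau>. gibbs n J \<tau> h0 h1 k
          (\<lambda>s. \<bar>overlap n k s ^ p
                 - (Edis D \<theta> n \<alpha> (\<lambda>J' \<tau>'. gibbs n J' \<tau>' h0 h1 k (overlap n k))) ^ p\<bar>))))
     \<le> R / real n powr ((\<theta> - 1/2) / 6)) sequentially"
  proof eventually_elim
    case (elim n)
    interpret disorder_model D \<theta> n
    proof (rule disorder_model.intro)
      show "0 < n" using elim(3) by simp
    qed (rule D_prob D_borel D_nonneg D_L2, assumption)+
    define d where "d = real n powr (-1/4)"
    define \<epsilon> where "\<epsilon> = real n powr (-1/8)"
    have d: "0 < d" "0 < h_lo - d" "h_hi + d < 1" and \<epsilon>: "0 < \<epsilon>"
      using elim by (auto simp: d_def \<epsilon>_def)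
    define B where "B = real p * ((real k * (2 / real n) + real k ^ 2 * (6 * sqrt (C_P / real n) / d + 8 * d)) / (2 * \<epsilon>) + \<epsilon> / 2)"
    have B: "0 \<le> B" unfolding B_def using d(1) \<epsilon> C_P by simp
    have "(LBINT h0=h_lo..h_hi. (LBINT \<alpha>=a_lo..a_hi.
        Edis D \<theta> n \<alpha> (\<lambda>J \<tau>. gibbs n J \<tau> h0 h1 k
          (\<lambda>s. \<bar>overlap n k s ^ p
                 - (Edis D \<theta> n \<alpha> (\<lambda>J' \<tau>'. gibbs n J' \<tau>' h0 h1 k (overlap n k))) ^ p\<bar>))))
      \<le> B * (a_hi - a_lo)"
    proof (rule iterated_interval_integral_le[OF hrange(2) arange(2) bound_measurable[OF arange(1)] bound_nonneg[OF \<epsilon>] bound_le[OF \<epsilon>]])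
      fix h0 \<alpha> assume "h0 \<in> {h_lo..h_hi}" "\<alpha> \<in> {a_lo..a_hi}"
      then show "Edis D \<theta> n \<alpha> (\<lambda>J \<tau>. gibbs n J \<tau> h0 h1 k
          (\<lambda>s. \<bar>overlap n k s ^ p
                 - (Edis D \<theta> n \<alpha> (\<lambda>J' \<tau>'. gibbs n J' \<tau>' h0 h1 k (overlap n k))) ^ p\<bar>))
          \<le> bound p k h1 \<epsilon> h0 (max a_lo \<alpha>)"
        \<comment> \<open>On the integration interval \<open>max a_lo \<alpha>\<close> is \<alpha>;
          the maximum serves only measurability over all real \<alpha>.\<close>
        using overlap_deviation_le_bound[of h0 h1 \<epsilon> \<alpha> k p] hrange h1 \<epsilon> by simp
    next
      fix \<alpha> assume \<alpha>: "\<alpha> \<in> {a_lo..a_hi}"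
      have "(\<integral>h0. bound p k h1 \<epsilon> h0 \<alpha> \<partial>restrict_space lborel {h_lo..h_hi}) \<le> B"
        unfolding B_def
      proof (rule integral_bound_le[OF _ \<epsilon> hrange(2) _ d])
        fix h0 :: real assume h0: "0 < h0" "h0 < 1"
        show "prob_space.variance (law \<alpha>) (\<lambda>\<omega>. pressure n (fst \<omega>) (snd \<omega>) h0 h1) \<le> C_P / real n"
          using press_conc[OF elim(3) h0, of \<alpha> h1] \<alpha> arange h1 by (simp add: Edis_def)
      qed (use \<alpha> arange hrange C_P in auto)
      then show "(\<integral>h0. bound p k h1 \<epsilon> h0 (max a_lo \<alpha>) \<partial>restrict_space lborel {h_lo..h_hi}) \<le> B"
        using \<alpha> by simp
    qed
    \<comment> \<open>The interval of \<alpha> lies in (0, 1), so its length is less than 1.\<close>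
    also have "\<dots> \<le> B * 1" using B arange by (intro mult_left_mono) auto
    also have "\<dots> \<le> R / real n powr ((\<theta> - 1/2) / 6)"
      using elim(4) theta by (simp add: B_def d_def \<epsilon>_def)
    finally show ?case .
  qed
  then show ?thesis unfolding R_def eventually_sequentially by simp
qed

end
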